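(* Let $\pi$ be a permutation. Then $\pi$ is West-$3$-stack-sortable, i.e. $S^3(\pi)=\mathrm{id}$, if and only if $\pi$ avoids all of the following ten decorated patterns, each written as $(p; R; D)$, where $p$ is the underlying classical pattern, $R$ is the set of shaded boxes and $D$ is the set of boxes decorated with the pattern $12$: $$I_1=(23451;\ \emptyset;\ \emptyset),$$ $$I_2=(24351;\ \{(2,4),(2,5)\};\ \emptyset),$$ $$I_3=(32451;\ \{(1,3),(1,4),(1,5)\};\ \emptyset),$$ $$I_4=(42351;\ \{(1,4),(1,5),(2,4),(2,5)\};\ \emptyset),$$ $$I_5=(43251;\ \{(1,4),(1,5),(2,3),(2,4),(2,5)\};\ \emptyset),$$ $$J_{2,12}=(34251;\ \{(1,3),(1,4),(1,5),(2,4),(2,5)\};\ \emptyset),$$ $$J_{1,10}=(362451;\ \{(0,4),(0,5),(1,3),(1,4),(1,5),(1,6),(2,4),(2,6)\};\ \{(2,5)\}),$$ $$J_{2,10}=(364251;\ \{(0,4),(0,5),(1,3),(1,4),(1,5),(1,6),(2,4),(2,6),(3,4),(3,5),(3,6)\};\ \{(2,5)\}),$$ $$J_{1,11}=(7362451;\ \{(1,4),(1,5),(1,6),(1,7),(2,3),(2,4),(2,5),(2,6),(2,7),(3,4),(3,6),(3,7)\};\ \{(3,5)\}),$$ $$J_{2,11}=(7364251;\ \{(1,4),(1,5),(1,6),(1,7),(2,3),(2,4),(2,5),(2,6),(2,7),(3,4),(3,6),(3,7),(4,4),(4,5),(4,6),(4,7)\};\ \{(3,5)\}).$$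
   Context: A permutation of length $n$ is a bijection of $\{1,\dots,n\}$ to itself, written in one-line notation $\pi(1)\pi(2)\cdots\pi(n)$; $\mathrm{id}=12\cdots n$ is the identity permutation of the appropriate length. Stack-sort operator $S$: the entries of $\pi$ are read from left to right. When an entry $x$ is read, first all entries smaller than $x$ currently on the stack are popped (from the top) to the end of the output, then $x$ is pushed on the stack. After all entries have been read, the stack is emptied (from the top) to the output. The output is the permutation $S(\pi)$. Equivalently $S$ of the empty word is empty and $S(LmR)=S(L)S(R)m$ where $m$ is the largest entry of the word $LmR$. $S^k$ is the $k$-fold iterate; $\pi$ is West-$k$-stack-sortable if $S^k(\pi)=\mathrm{id}$. Patterns: let $p$ be a permutation of length $k$ and $\pi$ a permutation of length $n$. An occurrence of the classical pattern $p$ in $\pi$ is a choice of positions $t_1<\dots<t_k$ such that $\pi(t_1),\dots,\pi(t_k)$ are in the same relative order as $p(1),\dots,p(k)$. Let $v_1<\dots<v_k$ be the values $\pi(t_1),\dots,\pi(t_k)$ sorted increasingly, and put $t_0=v_0=0$, $t_{k+1}=v_{k+1}=n+1$. For $0\le i,j\le k$, the box $(i,j)$ of the occurrence is the set of points $(x,\pi(x))$ with $t_i<x<t_{i+1}$ and $v_j<\pi(x)<v_{j+1}$. For sets $R,D\subseteq\{0,\dots,k\}^2$, an occurrence of the decorated pattern $(p;R;D)$ in $\pi$ is an occurrence of $p$ such that (1) every box $(i,j)\in R$ (a shaded box) is empty, and (2) the points contained in the union of the boxes in $D$ avoid the pattern $12$, i.e. read from left to right their values are decreasing (no condition if $D=\emptyset$).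 A permutation avoids $(p;R;D)$ if it has no occurrence of it. *)

theory Defs
  imports "HOL-Combinatorics.Multiset_Permutations"
begin

text \<open>
  A permutation of length \<open>n\<close> is its one-line notation, i.e. an element of
  \<open>permutations_of_set {1..n}\<close> (a list with distinct entries and entry set \<open>{1..n}\<close>).
\<close>

text \<open>The head of the first argument is the top of the stack.  The stack always increases
  from the top down, so \<open>takeWhile\<close> yields exactly the stack entries smaller than \<open>x\<close>.\<close>

fun stack_run :: "nat list \<Rightarrow> nat list \<Rightarrow> nat list" where
  "stack_run st [] = st"
| "stack_run st (x # xs) =
     takeWhile (\<lambda>y. y < x) st @ stack_run (x # dropWhile (\<lambda>y. y < x) st) xs"

definition stack_sort :: "nat list \<Rightarrow> nat list" where
  "stack_sort w = stack_run [] w"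

definition west_stack_sortable :: "nat \<Rightarrow> nat list \<Rightarrow> bool" where
  "west_stack_sortable k w \<longleftrightarrow> (stack_sort ^^ k) w = [1..<length w + 1]"

lemma stack_run_append_max:
  assumes "\<forall>y\<in>set st. y < m" "\<forall>y\<in>set L. y < m"
  shows "stack_run st (L @ m # R) = stack_run st L @ stack_run [m] R"
  using assms
proof (induction L arbitrary: st)
  case Nil
  then have "takeWhile (\<lambda>y. y < m) st = st" "dropWhile (\<lambda>y. y < m) st = []"
    by simp_all
  show ?case
    by (simp only: append_Nil stack_run.simps \<open>takeWhile _ st = st\<close> \<open>dropWhile _ st = []\<close>)
next
  case (Cons x L)
  have "\<forall>y\<in>set (x # dropWhile (\<lambda>y. y < x) st). y < m"
    using Cons.prems by (auto dest: set_dropWhileD)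
  then show ?case
    using Cons by simp
qed

lemma stack_run_bottom_max:
  assumes "\<forall>y\<in>set R. y < m"
  shows "stack_run (st @ [m]) R = stack_run st R @ [m]"
  using assms
proof (induction R arbitrary: st)
  case Nil
  then show ?case by simp
next
  case (Cons x R)
  have t: "takeWhile (\<lambda>y. y < x) (st @ [m]) = takeWhile (\<lambda>y. y < x) st"
    using Cons.prems by (induction st) auto
  have d: "dropWhile (\<lambda>y. y < x) (st @ [m]) = dropWhile (\<lambda>y. y < x) st @ [m]"
    using Cons.prems by (induction st) auto
  show ?case
    using Cons.IH[of "x # dropWhile (\<lambda>y. y < x) st"] Cons.prems by (simp add: t d)
qed

lemma stack_sort_Nil: "stack_sort [] = []"
  by (simp add: stack_sort_def)

lemma stack_sort_max:
  assumes "\<forall>y\<in>set L \<union> set R. y < m"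
  shows "stack_sort (L @ m # R) = stack_sort L @ stack_sort R @ [m]"
  using assms stack_run_append_max[of "[]" m L R] stack_run_bottom_max[of R m "[]"]
  by (simp add: stack_sort_def)

text \<open>Positions are counted from 1.\<close>

definition entry :: "nat list \<Rightarrow> nat \<Rightarrow> nat" where
  "entry w x = w ! (x - 1)"

definition classical_occurrence :: "nat list \<Rightarrow> nat list \<Rightarrow> nat list \<Rightarrow> bool" where
  "classical_occurrence p w ts \<longleftrightarrow>
     length ts = length p \<and> set ts \<subseteq> {1..length w} \<and> sorted_wrt (<) ts \<and>
     (\<forall>a<length p. \<forall>b<length p. entry w (ts ! a) < entry w (ts ! b) \<longleftrightarrow> p ! a < p ! b)"

text \<open>Indexing the next two lists gives \<open>t\<^sub>0, t\<^sub>1, \<dots>, t\<^sub>k, t\<^sub>k\<^sub>+\<^sub>1\<close> and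
  \<open>v\<^sub>0, v\<^sub>1, \<dots>, v\<^sub>k, v\<^sub>k\<^sub>+\<^sub>1\<close>, with \<open>t\<^sub>0 = v\<^sub>0 = 0\<close> and \<open>t\<^sub>k\<^sub>+\<^sub>1 = v\<^sub>k\<^sub>+\<^sub>1 = n + 1\<close>.\<close>

definition grid_positions :: "nat list \<Rightarrow> nat list \<Rightarrow> nat list" where
  "grid_positions w ts = 0 # ts @ [length w + 1]"

definition grid_values :: "nat list \<Rightarrow> nat list \<Rightarrow> nat list" where
  "grid_values w ts = 0 # sort (map (entry w) ts) @ [length w + 1]"

definition box_points :: "nat list \<Rightarrow> nat list \<Rightarrow> nat \<times> nat \<Rightarrow> (nat \<times> nat) set" where
  "box_points w ts = (\<lambda>(i, j). {(x, entry w x) | x. x \<in> {1..length w} \<and>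
     grid_positions w ts ! i < x \<and> x < grid_positions w ts ! (i + 1) \<and>
     grid_values w ts ! j < entry w x \<and> entry w x < grid_values w ts ! (j + 1)})"

definition avoids_12 :: "(nat \<times> nat) set \<Rightarrow> bool" where
  "avoids_12 A \<longleftrightarrow> \<not> (\<exists>x y x' y'. (x, y) \<in> A \<and> (x', y') \<in> A \<and> x < x' \<and> y < y')"

text \<open>A decorated pattern is a triple \<open>(p, R, D)\<close>: underlying classical pattern, shaded boxes,
  boxes decorated with the pattern 12.\<close>

type_synonym decorated_pattern = "nat list \<times> (nat \<times> nat) set \<times> (nat \<times> nat) set"

definition occurrence :: "decorated_pattern \<Rightarrow> nat list \<Rightarrow> nat list \<Rightarrow> bool" where
  "occurrence = (\<lambda>(p, R, D) w ts. classical_occurrence p w ts \<and>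
     (\<forall>b\<in>R. box_points w ts b = {}) \<and> avoids_12 (\<Union>b\<in>D. box_points w ts b))"

definition avoids :: "nat list \<Rightarrow> decorated_pattern \<Rightarrow> bool" where
  "avoids w P \<longleftrightarrow> \<not> (\<exists>ts. occurrence P w ts)"

definition pat_I1 :: decorated_pattern where
  "pat_I1 = ([2,3,4,5,1], {}, {})"

definition pat_I2 :: decorated_pattern where
  "pat_I2 = ([2,4,3,5,1], {(2,4),(2,5)}, {})"

definition pat_I3 :: decorated_pattern where
  "pat_I3 = ([3,2,4,5,1], {(1,3),(1,4),(1,5)}, {})"

definition pat_I4 :: decorated_pattern where
  "pat_I4 = ([4,2,3,5,1], {(1,4),(1,5),(2,4),(2,5)}, {})"

definition pat_I5 :: decorated_pattern where
  "pat_I5 = ([4,3,2,5,1], {(1,4),(1,5),(2,3),(2,4),(2,5)}, {})"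

definition pat_J2_12 :: decorated_pattern where
  "pat_J2_12 = ([3,4,2,5,1], {(1,3),(1,4),(1,5),(2,4),(2,5)}, {})"

definition pat_J1_10 :: decorated_pattern where
  "pat_J1_10 = ([3,6,2,4,5,1],
     {(0,4),(0,5),(1,3),(1,4),(1,5),(1,6),(2,4),(2,6)}, {(2,5)})"

definition pat_J2_10 :: decorated_pattern where
  "pat_J2_10 = ([3,6,4,2,5,1],
     {(0,4),(0,5),(1,3),(1,4),(1,5),(1,6),(2,4),(2,6),(3,4),(3,5),(3,6)}, {(2,5)})"

definition pat_J1_11 :: decorated_pattern where
  "pat_J1_11 = ([7,3,6,2,4,5,1],
     {(1,4),(1,5),(1,6),(1,7),(2,3),(2,4),(2,5),(2,6),(2,7),(3,4),(3,6),(3,7)}, {(3,5)})"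

definition pat_J2_11 :: decorated_pattern where
  "pat_J2_11 = ([7,3,6,4,2,5,1],
     {(1,4),(1,5),(1,6),(1,7),(2,3),(2,4),(2,5),(2,6),(2,7),(3,4),(3,6),(3,7),
      (4,4),(4,5),(4,6),(4,7)}, {(3,5)})"

end

theory Submission
  imports Defs
begin

text \<open>
  An inversion \<open>b a\<close> of a word survives one pass through the stack iff some \<open>c > b\<close> stands between
  \<open>b\<close> and \<open>a\<close>.  Hence \<open>S\<^sup>3(\<pi>)\<close> is not the identity iff there are values \<open>a < b < c\<close> such that \<open>c\<close>
  precedes \<open>a\<close> but not \<open>b\<close> in \<open>S\<^sup>2(\<pi>)\<close>.  Expanding this in \<open>\<pi>\<close> gives witnesses \<open>d < e\<close> with \<open>e\<close>
  after \<open>b, c, d\<close> and before \<open>a\<close>, and the patterns arise from the possible orders of \<open>b, c, d\<close>.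
  If \<open>b\<close> precedes \<open>c\<close>, or nothing larger than \<open>c\<close> separates \<open>c\<close> from \<open>b\<close>, then one of
  \<open>I\<^sub>1, \<dots>, I\<^sub>5\<close> occurs.  Otherwise the first separating entry \<open>f\<close> plays the role of 4 in
  \<open>J\<^sub>2\<^sub>,\<^sub>1\<^sub>2\<close> if \<open>f < e\<close>, and of 6 in the other four patterns if \<open>f > e\<close> and \<open>d\<close> is chosen maximal.
  Conversely, an occurrence of one of these five patterns with \<open>c\<close> maximal produces such \<open>a, b, c\<close>.
\<close>

section \<open>Inversions of a stack-sorted word\<close>

fun precedes :: "'a list \<Rightarrow> 'a \<Rightarrow> 'a \<Rightarrow> bool" where
  "precedes [] x y \<longleftrightarrow> False"
| "precedes (z # zs) x y \<longleftrightarrow> x = z \<and> y \<in> set zs \<or> precedes zs x y"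

lemma precedes_append:
  "precedes (xs @ ys) x y \<longleftrightarrow> precedes xs x y \<or> precedes ys x y \<or> x \<in> set xs \<and> y \<in> set ys"
  by (induction xs) auto

lemma precedes_in_set: "precedes xs x y \<Longrightarrow> x \<in> set xs \<and> y \<in> set xs"
  by (induction xs) auto

lemma not_precedes_iff:
  assumes "distinct xs" "x \<in> set xs" "y \<in> set xs" "x \<noteq> y"
  shows "\<not> precedes xs x y \<longleftrightarrow> precedes xs y x"
  using assms by (induction xs) (auto dest: precedes_in_set)

lemma precedes_nth_iff:
  assumes "distinct xs" "i < length xs" "j < length xs"
  shows "precedes xs (xs ! i) (xs ! j) \<longleftrightarrow> i < j"
  using assms
proof (induction xs arbitrary: i j)
  case (Cons z zs)
  then show ?case
    by (cases i; cases j) (auto dest: precedes_in_set)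
qed simp

lemma sorted_iff_no_inversion:
  fixes xs :: "'a::linorder list"
  shows "sorted xs \<longleftrightarrow> \<not> (\<exists>x y. y < x \<and> precedes xs x y)"
  by (induction xs) (auto simp: not_less dest: precedes_in_set leD)

text \<open>The recursion S(LmR) = S(L) S(R) m splits a word at its largest entry, and this is the
  induction scheme that fits it.\<close>

lemma word_max_induct [consumes 1, case_names Nil max]:
  fixes w :: "'a::linorder list"
  assumes "distinct w"
    and "P []"
    and "\<And>L m R. distinct (L @ m # R) \<Longrightarrow> \<forall>y\<in>set L \<union> set R. y < m \<Longrightarrow> P L \<Longrightarrow> P R \<Longrightarrow> P (L @ m # R)"
  shows "P w"
  using assms(1)
proof (induction w rule: length_induct)
  case (1 w)
  show ?case
  proof (cases "w = []")
    case False
    then have "Max (set w) \<in> set w" by simp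
    then obtain L R where w: "w = L @ Max (set w) # R" by (meson split_list)
    define m where "m = Max (set w)"
    have w': "w = L @ m # R" using w by (simp add: m_def)
    have "y < m" if "y \<in> set L \<union> set R" for y
    proof -
      have "y \<in> set w" using that by (subst w') auto
      then have "y \<le> m" by (simp add: m_def)
      moreover have "y \<noteq> m" using that 1(2) unfolding w' by auto
      ultimately show ?thesis by simp
    qed
    moreover have "P L" "P R" using 1 unfolding w' by auto
    ultimately show ?thesis using assms(3) 1(2) unfolding w' by blast
  qed (use assms(2) in simp)
qed

lemma mset_stack_sort: "distinct w \<Longrightarrow> mset (stack_sort w) = mset w"
  by (induction rule: word_max_induct) (simp_all add: stack_sort_Nil stack_sort_max)

lemma set_stack_sort: "distinct w \<Longrightarrow> set (stack_sort w) = set w"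
  by (metis mset_stack_sort set_mset_mset)

lemma distinct_stack_sort: "distinct w \<Longrightarrow> distinct (stack_sort w)"
  by (metis mset_stack_sort mset_eq_imp_distinct_iff)

text \<open>Split the word as \<open>L @ m # R\<close>. When \<open>b\<close> stands in
  \<open>L\<close> and \<open>a\<close> in \<open>R\<close>, the maximum \<open>m\<close> serves as
  \<open>c\<close>. When both lie in the same part, every entry between them lies there too and the
  induction hypothesis applies. The remaining cases are impossible or make both sides false.\<close>

lemma inversion_stack_sort:
  assumes "distinct w" "a < b"
  shows "precedes (stack_sort w) b a \<longleftrightarrow> (\<exists>c>b. precedes w b c \<and> precedes w c a)"
  using assms(1)
proof (induction rule: word_max_induct)
  case Nil
  then show ?case by (simp add: stack_sort_Nil)
next
  case (max L m R)
  have S: "stack_sort (L @ m # R) = stack_sort L @ stack_sort R @ [m]"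
    using max(2) by (rule stack_sort_max)
  have notin: "x \<notin> set xs \<or> y \<notin> set xs \<Longrightarrow> \<not> precedes xs x y" for xs :: "nat list" and x y
    using precedes_in_set by metis
  have LR: "set L \<inter> set R = {}" "m \<notin> set L" "m \<notin> set R" "distinct L" "distinct R" using max(1) by auto
  note sets = LR(4,5)[THEN set_stack_sort]
  consider "b \<notin> set (L @ m # R) \<or> a \<notin> set (L @ m # R)" | "b = m" | "a = m" "b \<in> set L \<union> set R"
    | "b \<in> set L" "a \<in> set L" | "b \<in> set L" "a \<in> set R"
    | "b \<in> set R" "a \<in> set L" | "b \<in> set R" "a \<in> set R"
    by auto
  then show ?case
  proof cases
    case 1
    then show ?thesis using S sets by (auto simp: precedes_append notin)
  next
    case 2
    then have "\<not> precedes (stack_sort (L @ m # R)) b a" using S LR sets by (auto simp: precedes_append notin)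
    moreover have "\<not> (b < c \<and> precedes (L @ m # R) b c)" for c
      using 2 max(2) notin[of c "L @ m # R"] precedes_in_set[of "L @ m # R" b c] by (auto dest: less_asym)
    ultimately show ?thesis by blast
  next
    case 3
    then show ?thesis using max(2) assms(2) by (meson less_asym)
  next
    case 4
    then have "a \<notin> set R" "b \<notin> set R" "a \<noteq> m" "b \<noteq> m" using LR by auto
    then show ?thesis using S 4 LR sets max(3) by (auto simp: precedes_append notin dest: precedes_in_set)
  next
    case 5
    then have "b < m" using max(2) by auto
    then show ?thesis using S 5 sets by (auto simp: precedes_append intro!: exI[of _ m])
  next
    case 6
    then have "a \<notin> set R" "b \<notin> set L" "a \<noteq> m" "b \<noteq> m" using LR by auto
    then show ?thesis using S 6 LR sets by (auto simp: precedes_append notin dest: precedes_in_set)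
  next
    case 7
    then have "a \<notin> set L" "b \<notin> set L" "a \<noteq> m" "b \<noteq> m" using LR by auto
    then show ?thesis using S 7 LR sets max(4) by (auto simp: precedes_append notin dest: precedes_in_set)
  qed
qed

section \<open>Obstructions to sorting in three passes\<close>

text \<open>Throughout, a permutation is a value function \<open>v\<close> on a set \<open>A\<close> of positions, and points are
  named by their positions.  Entry \<open>x\<close> is overtaken before \<open>y\<close> if a larger entry in between expels
  it from the stack.  If \<open>v y < v x\<close>, then \<open>x\<close> precedes \<open>y\<close> after one pass iff \<open>overtaken A v x y\<close>,
  and after two passes iff \<open>overtaken2 A v x y\<close>.\<close>

definition overtaken :: "nat set \<Rightarrow> (nat \<Rightarrow> nat) \<Rightarrow> nat \<Rightarrow> nat \<Rightarrow> bool" where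
  "overtaken A v x y \<longleftrightarrow> (\<exists>z\<in>A. x < z \<and> z < y \<and> v x < v z)"

definition overtaken2 :: "nat set \<Rightarrow> (nat \<Rightarrow> nat) \<Rightarrow> nat \<Rightarrow> nat \<Rightarrow> bool" where
  "overtaken2 A v x y \<longleftrightarrow>
     (\<exists>d\<in>A. \<exists>e\<in>A. v x < v d \<and> v d < v e \<and> d < e \<and> e < y \<and> \<not> overtaken A v d x)"

definition obstruction :: "nat set \<Rightarrow> (nat \<Rightarrow> nat) \<Rightarrow> bool" where
  "obstruction A v \<longleftrightarrow> (\<exists>a\<in>A. \<exists>b\<in>A. \<exists>c\<in>A. v a < v b \<and> v b < v c \<and>
     overtaken2 A v c a \<and> \<not> overtaken2 A v c b)"

text \<open>A crest is an occurrence of \<open>J\<^sub>2\<^sub>,\<^sub>1\<^sub>2\<close>.  A high crest unifies the four remaining patterns: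
  position \<open>f\<close> carries the value 6, \<open>d\<close> may lie on either side of \<open>b\<close>, and the last clause is
  satisfied either vacuously (the \<open>10\<close>-patterns) or thanks to an early entry 7
  (the \<open>11\<close>-patterns).\<close>

definition crest :: "nat set \<Rightarrow> (nat \<Rightarrow> nat) \<Rightarrow> nat \<Rightarrow> nat \<Rightarrow> nat \<Rightarrow> nat \<Rightarrow> nat \<Rightarrow> bool" where
  "crest A v a b c d e \<longleftrightarrow> a \<in> A \<and> b \<in> A \<and> c \<in> A \<and> d \<in> A \<and> e \<in> A \<and>
     c < d \<and> d < b \<and> b < e \<and> e < a \<and> v a < v b \<and> v b < v c \<and> v c < v d \<and> v d < v e \<and>
     (\<forall>x\<in>A. c < x \<and> x < d \<longrightarrow> v x \<le> v c) \<and>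
     (\<forall>x\<in>A. d < x \<and> x < b \<longrightarrow> v x \<le> v d)"

definition high_crest ::
    "nat set \<Rightarrow> (nat \<Rightarrow> nat) \<Rightarrow> nat \<Rightarrow> nat \<Rightarrow> nat \<Rightarrow> nat \<Rightarrow> nat \<Rightarrow> nat \<Rightarrow> bool" where
  "high_crest A v a b c d e f \<longleftrightarrow>
     a \<in> A \<and> b \<in> A \<and> c \<in> A \<and> d \<in> A \<and> e \<in> A \<and> f \<in> A \<and>
     c < f \<and> f < b \<and> f < d \<and> d \<noteq> b \<and> b < e \<and> d < e \<and> e < a \<and>
     v a < v b \<and> v b < v c \<and> v c < v d \<and> v d < v e \<and> v e < v f \<and>
     (\<forall>x\<in>A. c < x \<and> x < f \<longrightarrow> v x \<le> v c) \<and>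
     (\<forall>x\<in>A. f < x \<and> x < b \<longrightarrow> v x \<le> v f \<and> \<not> (v d < v x \<and> v x < v e)) \<and>
     (\<forall>x\<in>A. \<forall>y\<in>A. f < x \<and> x < y \<and> y < b \<and> v e < v x \<longrightarrow> v y \<le> v x) \<and>
     (\<forall>x\<in>A. d < x \<and> x < b \<longrightarrow> v x \<le> v d) \<and>
     (\<forall>x\<in>A. x < c \<and> v d < v x \<and> v x < v f \<longrightarrow> (\<exists>g\<in>A. x < g \<and> g < c \<and> v f < v g))"

text \<open>The five disjuncts are the patterns 23451, 24351, 32451, 42351, 43251 in this order,
  with \<open>a\<close> to \<open>e\<close> naming the positions of the values 1 to 5.\<close>

definition contains_I :: "nat set \<Rightarrow> (nat \<Rightarrow> nat) \<Rightarrow> bool" where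
  "contains_I A v \<longleftrightarrow> (\<exists>a\<in>A. \<exists>b\<in>A. \<exists>c\<in>A. \<exists>d\<in>A. \<exists>e\<in>A. e < a \<and>
     v a < v b \<and> v b < v c \<and> v c < v d \<and> v d < v e \<and>
     (b < c \<and> c < d \<and> d < e \<or>
      b < d \<and> d < c \<and> c < e \<and> \<not> overtaken A v d c \<or>
      c < b \<and> b < d \<and> d < e \<and> \<not> overtaken A v c b \<or>
      d < b \<and> b < c \<and> c < e \<and> \<not> overtaken A v d c \<or>
      d < c \<and> c < b \<and> b < e \<and> \<not> overtaken A v d c \<and> \<not> overtaken A v c b))"

section \<open>Obstructions versus the \<open>I\<close>-configurations, crests and high
  crests\<close>

context
  fixes A :: "nat set" and v :: "nat \<Rightarrow> nat"
  assumes fin: "finite A" and inj: "inj_on v A"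
begin

lemma val_eq: "x \<in> A \<Longrightarrow> y \<in> A \<Longrightarrow> v x = v y \<Longrightarrow> x = y"
  using inj by (auto dest: inj_onD)

lemma obtain_highest:
  assumes "x \<in> A" "P x"
  obtains y where "y \<in> A" "P y" "\<And>z. z \<in> A \<Longrightarrow> P z \<Longrightarrow> v z \<le> v y"
proof -
  have "\<forall>y. y \<in> A \<and> P y \<longrightarrow> v y < Suc (Max (v ` A))"
    using fin by (auto simp: less_Suc_eq_le)
  then show ?thesis
    using ex_has_greatest_nat[of "\<lambda>y. y \<in> A \<and> P y" x v] assms that by blast
qed

text \<open>Makes the inductions below terminate: passing to a higher entry shrinks the distance to
  the largest value.\<close>

lemma higher_diff:
  assumes "x \<in> A" "v y < v x"
  shows "Max (v ` A) - v x < Max (v ` A) - v y"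
proof -
  have "v x \<le> Max (v ` A)" using assms fin by simp
  then show ?thesis using assms by linarith
qed

lemma not_overtaken_earlier: "y \<le> x \<Longrightarrow> \<not> overtaken A v x y"
  by (auto simp: overtaken_def)

lemma overtaken2I:
  assumes "d \<in> A" "e \<in> A" "v x < v d" "v d < v e" "d < e" "e < y" "\<not> overtaken A v d x"
  shows "overtaken2 A v x y"
  using assms unfolding overtaken2_def by blast

text \<open>The extra fact \<open>x < e\<close> holds because an \<open>e\<close> before
  \<open>x\<close> would lie between \<open>d\<close> and \<open>x\<close> and overtake
  \<open>d\<close>.\<close>

lemma overtaken2_cases:
  assumes "overtaken2 A v x y" "y \<in> A" "x \<in> A"
  obtains d e where "d \<in> A" "e \<in> A" "v x < v d" "v d < v e" "d < e" "x < e" "e < y"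
    "\<And>z. z \<in> A \<Longrightarrow> d < z \<Longrightarrow> z < x \<Longrightarrow> v z \<le> v d"
proof -
  obtain d e where de: "d \<in> A" "e \<in> A" "v x < v d" "v d < v e" "d < e" "e < y"
     "\<not> overtaken A v d x"
    using assms(1) by (auto simp: overtaken2_def)
  moreover have "x < e"
  proof (rule ccontr)
    assume "\<not> x < e"
    then have "e < x" using de by (metis less_trans nat_neq_iff)
    then show False using de by (auto simp: overtaken_def)
  qed
  ultimately show ?thesis
    using that[of d e] unfolding overtaken_def by (meson not_less)
qed

lemma overtaken2_imp_overtaken:
  assumes "overtaken2 A v x y" "y \<in> A" "x \<in> A"
  shows "overtaken A v x y"
  by (rule overtaken2_cases[OF assms]) (auto simp: overtaken_def intro: less_trans)

lemma contains_I_23451: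
  assumes "a \<in> A" "b \<in> A" "c \<in> A" "d \<in> A" "e \<in> A" "b < c" "c < d" "d < e" "e < a"
    "v a < v b" "v b < v c" "v c < v d" "v d < v e"
  shows "contains_I A v"
  using assms unfolding contains_I_def by blast

text \<open>In each of the five orders \<open>d\<close> and \<open>e\<close> keep \<open>c\<close>
  before \<open>a\<close> for two passes, whereas nothing larger than \<open>c\<close> stands
  between \<open>c\<close> and a later \<open>b\<close>, so \<open>c\<close> is not even overtaken
  before \<open>b\<close>.\<close>

lemma contains_I_imp_obstruction:
  assumes "contains_I A v"
  shows "obstruction A v"
proof -
  obtain a b c d e where
    A: "a \<in> A" "b \<in> A" "c \<in> A" "d \<in> A" "e \<in> A"
    and v: "e < a" "v a < v b" "v b < v c" "v c < v d" "v d < v e"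
    and *: "b < c \<and> c < d \<and> d < e \<or>
      b < d \<and> d < c \<and> c < e \<and> \<not> overtaken A v d c \<or>
      c < b \<and> b < d \<and> d < e \<and> \<not> overtaken A v c b \<or>
      d < b \<and> b < c \<and> c < e \<and> \<not> overtaken A v d c \<or>
      d < c \<and> c < b \<and> b < e \<and> \<not> overtaken A v d c \<and> \<not> overtaken A v c b"
    using assms unfolding contains_I_def by blast
  have "overtaken2 A v c a"
    using * v A not_overtaken_earlier[of c d] by (intro overtaken2I[of d e]) auto
  moreover have "\<not> overtaken A v c b"
    using * by (auto simp: overtaken_def)
  then have "\<not> overtaken2 A v c b" using overtaken2_imp_overtaken A by blast
  ultimately show ?thesis using A v by (auto simp: obstruction_def)
qed

text \<open>Induction on the gap between \<open>v c\<close> and the largest value replaces the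
  choice of \<open>c\<close> as high as possible; the other entries of the crest are kept.\<close>

lemma crest_imp_obstruction:
  assumes "crest A v a b c d e"
  shows "obstruction A v"
  using assms
proof (induction c arbitrary: d rule: measure_induct_rule[where f = "\<lambda>c. Max (v ` A) - v c"])
  case (less c)
  then have cr: "crest A v a b c d e" by blast
  have A: "a \<in> A" "b \<in> A" "c \<in> A" "d \<in> A" "e \<in> A"
    and o: "c < d" "d < b" "b < e" "e < a" "v a < v b" "v b < v c" "v c < v d" "v d < v e"
    and cd: "\<And>x. x \<in> A \<Longrightarrow> c < x \<Longrightarrow> x < d \<Longrightarrow> v x \<le> v c"
    and db: "\<And>x. x \<in> A \<Longrightarrow> d < x \<Longrightarrow> x < b \<Longrightarrow> v x \<le> v d"
    using cr unfolding crest_def by blast+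
  \<comment> \<open>A witness \<open>d'\<close> of \<open>overtaken2 A v c b\<close> is a better choice of \<open>c\<close>, or else yields 23451.\<close>
  show ?case
  proof (rule ccontr)
    assume no: "\<not> obstruction A v"
    have "overtaken2 A v c a"
      using o A by (intro overtaken2I[of d e] not_overtaken_earlier) auto
    then have "overtaken2 A v c b" using no A o unfolding obstruction_def by blast
    then obtain d' e' where A': "d' \<in> A" "e' \<in> A"
      and o': "v c < v d'" "v d' < v e'" "d' < e'" "c < e'" "e' < b"
      and dc: "\<And>z. z \<in> A \<Longrightarrow> d' < z \<Longrightarrow> z < c \<Longrightarrow> v z \<le> v d'"
      using overtaken2_cases A(2,3) by blast
    \<comment> \<open>The entry \<open>e'\<close> exceeds \<open>c\<close>, so it cannot lie
      strictly between \<open>c\<close> and \<open>d\<close>.\<close>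
    have e': "d \<le> e'" using cd[of e'] A' o' by linarith
    then have ve': "v e' \<le> v d" using db[of e'] A' o' by (cases "e' = d") auto
    show False
    proof (cases "c < d'")
      case True
      then have "d \<le> d'" using cd[of d'] A' o' by linarith
      then have "contains_I A v"
        using A A' o o' ve' True contains_I_23451[of a c d' e' e] by auto
      then show False using contains_I_imp_obstruction no by blast
    next
      case False
      then have "d' < c" using o' by (metis nat_neq_iff less_irrefl)
      \<comment> \<open>Before \<open>c\<close> this is the fact that \<open>d'\<close> is not
        overtaken; from \<open>c\<close> up to \<open>d\<close> the entries are at most
        \<open>c\<close>, which is below \<open>d'\<close>.\<close>
      have "v x \<le> v d'" if "x \<in> A" "d' < x" "x < d" for x
        using dc[of x] cd[of x] that o' by (cases x c rule: linorder_cases) auto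
      then have "crest A v a b d' d e"
        unfolding crest_def using A A' o o' ve' db \<open>d' < c\<close> by auto
      then show False using less.IH[OF higher_diff[OF A'(1) o'(1)]] no by blast
    qed
  qed
qed

text \<open>The same induction on the height of \<open>c\<close>. In addition, the clause on the
  entries left of \<open>c\<close> has to survive when \<open>c\<close> moves to
  \<open>d'\<close>.\<close>

lemma high_crest_imp_obstruction:
  assumes "high_crest A v a b c d e f"
  shows "obstruction A v"
  using assms
proof (induction c rule: measure_induct_rule[where f = "\<lambda>c. Max (v ` A) - v c"])
  case (less c)
  then have cr: "high_crest A v a b c d e f" by blast
  have A: "a \<in> A" "b \<in> A" "c \<in> A" "d \<in> A" "e \<in> A" "f \<in> A"
    and o: "c < f" "f < b" "f < d" "d \<noteq> b" "b < e" "d < e" "e < a"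
      "v a < v b" "v b < v c" "v c < v d" "v d < v e" "v e < v f"
    and cf: "\<And>x. x \<in> A \<Longrightarrow> c < x \<Longrightarrow> x < f \<Longrightarrow> v x \<le> v c"
    and fb: "\<And>x. x \<in> A \<Longrightarrow> f < x \<Longrightarrow> x < b \<Longrightarrow> v x \<le> v f"
    and fb': "\<And>x. x \<in> A \<Longrightarrow> f < x \<Longrightarrow> x < b \<Longrightarrow> v x \<le> v d \<or> v e \<le> v x"
    and decr: "\<And>x y. x \<in> A \<Longrightarrow> y \<in> A \<Longrightarrow> f < x \<Longrightarrow> x < y \<Longrightarrow> y < b \<Longrightarrow> v e < v x \<Longrightarrow> v y \<le> v x"
    and db: "\<And>x. x \<in> A \<Longrightarrow> d < x \<Longrightarrow> x < b \<Longrightarrow> v x \<le> v d"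
    and left: "\<And>x. x \<in> A \<Longrightarrow> x < c \<Longrightarrow> v d < v x \<Longrightarrow> v x < v f \<Longrightarrow> \<exists>g\<in>A. x < g \<and> g < c \<and> v f < v g"
    using cr unfolding high_crest_def by (blast, blast, blast, blast, blast, blast, blast, blast, blast, blast,
      blast, blast, blast, blast, blast, blast, blast, blast, blast, blast, force+)
  show ?case
  proof (rule ccontr)
    assume no: "\<not> obstruction A v"
    then have noI: "\<not> contains_I A v" using contains_I_imp_obstruction by blast
    have "overtaken2 A v c a"
      using o A by (intro overtaken2I[of d e] not_overtaken_earlier) auto
    then have "overtaken2 A v c b" using no A o unfolding obstruction_def by blast
    then obtain d' e' where A': "d' \<in> A" "e' \<in> A"
      and o': "v c < v d'" "v d' < v e'" "d' < e'" "c < e'" "e' < b"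
      and dc: "\<And>z. z \<in> A \<Longrightarrow> d' < z \<Longrightarrow> z < c \<Longrightarrow> v z \<le> v d'"
      using overtaken2_cases A(2,3) by blast
    have e': "f \<le> e'" using cf[of e'] A' o' by linarith
    then have ve': "v e' \<le> v f" using fb[of e'] A' o' by (cases "e' = f") auto
    show False
    proof (cases "c < d'")
      case True
      then have d': "f < d'" using cf[of d'] A' o' ve' by (cases d' f rule: linorder_cases) auto
      \<comment> \<open>Between \<open>f\<close> and \<open>b\<close> no value lies strictly between
        \<open>d\<close> and \<open>e\<close>, and an entry above \<open>e\<close> cannot be
        followed there by the higher \<open>e'\<close>. Also \<open>d'\<close> differs from
        \<open>e\<close>, which comes after \<open>b\<close>.\<close>
      have "v d' \<le> v d" using fb'[of d'] decr[of d' e'] A' A o' d' val_eq[of d' e] o by fastforce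
      then consider "d' = d" | "v d' < v d" using A A' val_eq le_neq_implies_less by blast
      then have "contains_I A v"
      proof cases
        case 1
        \<comment> \<open>Contradictory case: the higher entry \<open>e'\<close> would stand between
          \<open>d\<close> and \<open>b\<close>.\<close>
        then show ?thesis using db[of e'] A' o' by auto
      next
        case 2
        show ?thesis
        \<comment> \<open>The role of 4 in 23451 is played by \<open>d\<close> if it comes after
          \<open>d'\<close>. Otherwise \<open>e'\<close> lies between \<open>d\<close> and
          \<open>b\<close>, is at most as high as \<open>d\<close>, and takes that role.\<close>
        proof (cases "d' < d")
          case True
          then show ?thesis
            using A A' o o' 2 d' contains_I_23451[of a c d' d e] by auto
        next
          case False
          then have "v e' \<le> v d" using db[of e'] A' o' by auto
          then show ?thesis
            using A A' o o' 2 d' contains_I_23451[of a c d' e' e] by auto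
        qed
      qed
      then show False using noI by blast
    next
      case False
      then have "d' < c" using o' by (metis nat_neq_iff less_irrefl)
      \<comment> \<open>No entry between \<open>d'\<close> and \<open>c\<close> exceeds
        \<open>d'\<close>, which lies below \<open>f\<close>. So \<open>d'\<close> has no protecting
        \<open>g\<close>, and the left clause forces it to be at most as high as
        \<open>d\<close>.\<close>
      have "\<not> (\<exists>g\<in>A. d' < g \<and> g < c \<and> v f < v g)" using dc ve' o' by fastforce
      then have "v d' \<le> v d" using left[of d'] A' \<open>d' < c\<close> o' ve' by fastforce
      moreover have "d' \<noteq> d" using \<open>d' < c\<close> o by auto
      ultimately have vd': "v d' < v d" using A A' val_eq by (metis le_neq_implies_less)
      have "v x \<le> v d'" if "x \<in> A" "d' < x" "x < f" for x
        using dc[of x] cf[of x] that o' by (cases x c rule: linorder_cases) auto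
      moreover have "\<exists>g\<in>A. x < g \<and> g < d' \<and> v f < v g" if x: "x \<in> A" "x < d'" "v d < v x" "v x < v f" for x
      proof -
        obtain g where g: "g \<in> A" "x < g" "g < c" "v f < v g" using left[of x] x \<open>d' < c\<close> by auto
        \<comment> \<open>The protector \<open>g\<close> of \<open>x\<close> exceeds
          \<open>f\<close> and hence \<open>d'\<close>, so it cannot lie between \<open>d'\<close>
          and \<open>c\<close>.\<close>
        then have "g < d'" using dc[of g] ve' o' by (cases g d' rule: linorder_cases) auto
        then show ?thesis using g by blast
      qed
      ultimately have "high_crest A v a b d' d e f"
        unfolding high_crest_def using A A' o o' vd' \<open>d' < c\<close> fb fb' decr db by (auto simp: not_less)
      then show False using less.IH[OF higher_diff[OF A'(1) o'(1)]] no by blast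
    qed
  qed
qed

lemma obstruction_cases:
  assumes "obstruction A v"
  obtains "contains_I A v" | a b c d e where "crest A v a b c d e"
  | a b c d e f where "high_crest A v a b c d e f"
proof -
  obtain a b c where A: "a \<in> A" "b \<in> A" "c \<in> A" and vabc: "v a < v b" "v b < v c"
    and ca: "overtaken2 A v c a" and cb: "\<not> overtaken2 A v c b"
    using assms unfolding obstruction_def by blast
  obtain d0 e where "d0 \<in> A" "e \<in> A" "v c < v d0 \<and> v d0 < v e \<and> d0 < e \<and> \<not> overtaken A v d0 c" "e < a"
    using ca unfolding overtaken2_def by blast
  \<comment> \<open>Maximality of \<open>d\<close> is taken for fixed \<open>e\<close>; it later
    excludes values strictly between \<open>d\<close> and \<open>e\<close> in the column from
    \<open>f\<close> to \<open>b\<close>.\<close>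
  then obtain d where A': "d \<in> A" "e \<in> A"
    and d: "v c < v d \<and> v d < v e \<and> d < e \<and> \<not> overtaken A v d c" and "e < a"
    and max: "\<And>d'. d' \<in> A \<Longrightarrow> v c < v d' \<and> v d' < v e \<and> d' < e \<and> \<not> overtaken A v d' c \<Longrightarrow> v d' \<le> v d"
    using obtain_highest[of d0 "\<lambda>d. v c < v d \<and> v d < v e \<and> d < e \<and> \<not> overtaken A v d c"] by metis
  have o: "v c < v d" "v d < v e" "d < e" "e < a" and dc: "\<not> overtaken A v d c"
    using d \<open>e < a\<close> by auto
  \<comment> \<open>Otherwise \<open>x\<close> and \<open>y\<close> would witness
    \<open>overtaken2 A v c b\<close>.\<close>
  have free: "v y \<le> v x" if "x \<in> A" "y \<in> A" "v c < v x" "x < y" "y < b" "\<not> overtaken A v x c" for x y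
    using cb that unfolding overtaken2_def by fastforce
  have "c < e" using dc o A' A unfolding overtaken_def by (metis nat_neq_iff less_trans)
  \<comment> \<open>An \<open>e\<close> before \<open>b\<close> would contradict \<open>free\<close>
    for \<open>d\<close> and \<open>e\<close>.\<close>
  have "b < e" using free[of d e] A' o vabc dc by (cases b e rule: linorder_cases) auto
  have ne: "c \<noteq> d" "b \<noteq> d" "b \<noteq> c" using vabc o by auto
  show ?thesis
  proof (cases "b < c \<or> \<not> overtaken A v c b")
    case True
    \<comment> \<open>A \<open>d\<close> between \<open>c\<close> and \<open>b\<close> would itself
      overtake \<open>c\<close>.\<close>
    have "c < b \<Longrightarrow> c < d \<Longrightarrow> \<not> overtaken A v c b \<Longrightarrow> b < d"
      using ne A' o unfolding overtaken_def by (metis nat_neq_iff)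
    then have disj: "b < c \<and> c < d \<and> d < e \<or>
      b < d \<and> d < c \<and> c < e \<and> \<not> overtaken A v d c \<or>
      c < b \<and> b < d \<and> d < e \<and> \<not> overtaken A v c b \<or>
      d < b \<and> b < c \<and> c < e \<and> \<not> overtaken A v d c \<or>
      d < c \<and> c < b \<and> b < e \<and> \<not> overtaken A v d c \<and> \<not> overtaken A v c b"
      using dc True o \<open>c < e\<close> \<open>b < e\<close> ne by (metis nat_neq_iff)
    have "contains_I A v"
      unfolding contains_I_def
      by (rule bexI[OF _ A(1)], rule bexI[OF _ A(2)], rule bexI[OF _ A(3)],
        rule bexI[OF _ A'(1)], rule bexI[OF _ A'(2)]) (intro conjI disj o vabc)
    then show ?thesis by (rule that(1))
  next
    case False
    then have "c < b" "overtaken A v c b" using ne by auto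
    define f where "f = (LEAST x. x \<in> A \<and> c < x \<and> x < b \<and> v c < v x)"
    have f: "f \<in> A" "c < f" "f < b" "v c < v f"
      using \<open>overtaken A v c b\<close> unfolding overtaken_def f_def
      by (metis (mono_tags, lifting) LeastI)+
    have cf: "v x \<le> v c" if "x \<in> A" "c < x" "x < f" for x
      using that f not_less_Least[of x "\<lambda>x. x \<in> A \<and> c < x \<and> x < b \<and> v c < v x"]
      unfolding f_def[symmetric] by fastforce
    have fb: "v x \<le> v f" if "x \<in> A" "f < x" "x < b" for x
      using free[of f x] f that by (auto simp: overtaken_def)
    show ?thesis
    proof (cases "v f < v e")
      case True
      then have "crest A v a b c f e"
        unfolding crest_def using A A' f o vabc \<open>b < e\<close> cf fb by auto
      then show ?thesis by (rule that(2))
    next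
      case False
      then have "v e < v f" using f A' \<open>b < e\<close> val_eq[of e f] by fastforce
      \<comment> \<open>If nothing above \<open>f\<close> stood between \<open>x\<close> and
        \<open>c\<close>, the highest entry \<open>z\<close> from \<open>x\<close> up to just before
        \<open>c\<close> would not be overtaken before \<open>c\<close>, yet the higher
        \<open>f\<close> would follow it before \<open>b\<close>, against
        \<open>free\<close>.\<close>
      have protected: "\<exists>g\<in>A. x < g \<and> g < c \<and> v f < v g" if x: "x \<in> A" "x < c" "v c < v x" "v x < v f" for x
      proof (rule ccontr)
        assume "\<not> ?thesis"
        then have low: "\<And>g. g \<in> A \<Longrightarrow> x < g \<Longrightarrow> g < c \<Longrightarrow> v g \<le> v f" by fastforce
        obtain z where z: "z \<in> A" "x \<le> z \<and> z < c" and zmax: "\<And>z'. z' \<in> A \<Longrightarrow> x \<le> z' \<and> z' < c \<Longrightarrow> v z' \<le> v z"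
          using obtain_highest[of x "\<lambda>z. x \<le> z \<and> z < c"] x by blast
        have "v c < v z" using zmax[of x] x by simp
        moreover have "v z < v f"
          using low[of z] z x f val_eq[of z f] by (cases "z = x") fastforce+
        moreover have "\<not> overtaken A v z c" using zmax z by (fastforce simp: overtaken_def)
        ultimately show False using free[of z f] z f by auto
      qed
      \<comment> \<open>A \<open>d\<close> before \<open>c\<close> would be overtaken by its own
        protector \<open>g\<close>.\<close>
      have "\<not> d < c"
      proof
        assume "d < c"
        then obtain g where "g \<in> A" "d < g" "g < c" "v f < v g"
          using protected[of d] A' o \<open>v e < v f\<close> by auto
        then show False using dc o \<open>v e < v f\<close> by (auto simp: overtaken_def)
      qed
      then have "f < d" using cf[of d] A' o ne \<open>v e < v f\<close> by (cases d f rule: linorder_cases) auto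
      \<comment> \<open>An entry with a value strictly between \<open>d\<close> and \<open>e\<close>
        would come after \<open>c\<close> and before \<open>e\<close>, hence be a higher choice than
        \<open>d\<close>.\<close>
      have fbd: "v x \<le> v d \<or> v e \<le> v x" if "x \<in> A" "f < x" "x < b" for x
        using max[of x] that f o \<open>b < e\<close> by (fastforce simp: overtaken_def)
      have decr: "v y \<le> v x" if "x \<in> A" "y \<in> A" "f < x" "x < y" "y < b" "v e < v x" for x y
        using free[of x y] that f o not_overtaken_earlier[of c x] by auto
      have db: "v x \<le> v d" if "x \<in> A" "d < x" "x < b" for x
        using free[of d x] that A' o dc by auto
      have "high_crest A v a b c d e f"
        unfolding high_crest_def
        using A A' f o vabc \<open>b < e\<close> \<open>f < d\<close> \<open>v e < v f\<close> ne cf fb fbd protected decr db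
        by (auto simp: not_less)
      then show ?thesis by (rule that(3))
    qed
  qed
qed

theorem obstruction_iff:
  "obstruction A v \<longleftrightarrow> contains_I A v \<or> (\<exists>c d b e a. crest A v a b c d e) \<or>
     (\<exists>c f b d e a. high_crest A v a b c d e f)"
  using contains_I_imp_obstruction crest_imp_obstruction high_crest_imp_obstruction obstruction_cases
  by metis

end

section \<open>Occurrences of decorated patterns\<close>

text \<open>Rectangles with arbitrary open sides instead of grid boxes, so that adjacent shaded
  boxes can be merged.\<close>

definition points_within ::
    "nat list \<Rightarrow> nat \<Rightarrow> nat \<Rightarrow> nat \<Rightarrow> nat \<Rightarrow> (nat \<times> nat) set" where
  "points_within w t t' u u' =
     {(x, entry w x) | x. x \<in> {1..length w} \<and> t < x \<and> x < t' \<and> u < entry w x \<and> entry w x < u'}"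

lemma points_within_empty_iff:
  "points_within w t t' u u' = {} \<longleftrightarrow>
     (\<forall>x\<in>{1..length w}. t < x \<and> x < t' \<and> u < entry w x \<longrightarrow> u' \<le> entry w x)"
  unfolding points_within_def not_less[symmetric] by blast

lemma avoids_12_points_within_iff:
  "avoids_12 (points_within w t t' u u') \<longleftrightarrow>
     (\<forall>x\<in>{1..length w}. \<forall>y\<in>{1..length w}. t < x \<and> x < y \<and> y < t' \<and> u < entry w x \<and> entry w y < u'
        \<longrightarrow> entry w y \<le> entry w x)" (is "?L = ?R")
proof
  assume L: ?L
  show ?R
  proof (intro ballI impI, rule ccontr)
    fix x y assume xy: "x \<in> {1..length w}" "y \<in> {1..length w}"
      "t < x \<and> x < y \<and> y < t' \<and> u < entry w x \<and> entry w y < u'" "\<not> entry w y \<le> entry w x"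
    have "(x, entry w x) \<in> points_within w t t' u u'" "(y, entry w y) \<in> points_within w t t' u u'"
      unfolding points_within_def using xy by simp_all
    then show False
      using L xy(3,4) unfolding avoids_12_def not_le by blast
  qed
next
  assume R: ?R
  show ?L
    unfolding avoids_12_def
  proof (intro notI, elim exE conjE)
    fix x y x' y'
    assume "(x, y) \<in> points_within w t t' u u'" "(x', y') \<in> points_within w t t' u u'" "x < x'" "y < y'"
    then show False
      using R[rule_format, of x x'] unfolding points_within_def by simp
  qed
qed

lemma avoids_12_empty: "avoids_12 {}"
  by (simp add: avoids_12_def)

text \<open>\<open>q\<close> lists the indices of \<open>p\<close> by increasing entry, i.e. it is
  the inverse of \<open>p\<close> counted from 0. All pairwise comparisons then reduce to one
  increasing chain.\<close>

lemma order_isomorphic_iff: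
  fixes p :: "nat list" and g :: "'a \<Rightarrow> nat"
  assumes "length ts = length p" "mset q = mset [0..<length p]"
    and "sorted_wrt (<) (map ((!) p) q)"
  shows "(\<forall>a<length p. \<forall>b<length p. g (ts ! a) < g (ts ! b) \<longleftrightarrow> p ! a < p ! b) \<longleftrightarrow>
    sorted_wrt (<) (map (\<lambda>i. g (ts ! i)) q)" (is "?L \<longleftrightarrow> ?R")
proof
  have q: "set q = {..<length p}" "length q = length p"
    using assms(2) by (metis atLeast0LessThan set_mset_mset set_upt, metis assms(2) length_upt diff_zero size_mset)
  {
    assume ?L
    then show ?R
      using assms(3) q by (auto simp: sorted_wrt_iff_nth_less) (metis lessThan_iff nth_mem order_less_trans)
  }
  {
    assume r: ?R
    have mono: "i < j \<Longrightarrow> j < length q \<Longrightarrow> g (ts ! (q ! i)) < g (ts ! (q ! j)) \<and> p ! (q ! i) < p ! (q ! j)" for i j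
      using r assms(3) by (simp add: sorted_wrt_iff_nth_less)
    show ?L
    proof (intro allI impI)
      fix a b assume "a < length p" "b < length p"
      then obtain i j where ij: "i < length q" "j < length q" "a = q ! i" "b = q ! j"
        using q by (metis in_set_conv_nth lessThan_iff)
      show "g (ts ! a) < g (ts ! b) \<longleftrightarrow> p ! a < p ! b"
        unfolding ij using mono[of i j] mono[of j i] ij(1,2) by (cases i j rule: linorder_cases) auto
    qed
  }
qed

text \<open>Replaces the sorting inside \<open>grid_values\<close> by an explicit list, as
  \<open>q\<close> already puts the values in order.\<close>

lemma sort_map_nth:
  fixes g :: "'a \<Rightarrow> 'b::linorder"
  assumes "mset q = mset [0..<length ts]" "sorted_wrt (<) (map (\<lambda>i. g (ts ! i)) q)"
  shows "sort (map g ts) = map (\<lambda>i. g (ts ! i)) q"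
proof (rule properties_for_sort)
  have "mset (map (\<lambda>i. g (ts ! i)) q) = mset (map (\<lambda>i. g (ts ! i)) [0..<length ts])"
    using assms(1) by (simp only: mset_map)
  also have "map (\<lambda>i. g (ts ! i)) [0..<length ts] = map g ts"
    by (rule nth_equalityI) auto
  finally show "mset (map (\<lambda>i. g (ts ! i)) q) = mset (map g ts)" .
  show "sorted (map (\<lambda>i. g (ts ! i)) q)"
    using assms(2) by (rule sorted_wrt_mono_rel[rotated]) simp
qed

text \<open>The boxes of an occurrence with the sorted values supplied as \<open>us\<close>, so that
  the bounds can be read off for concrete lists.\<close>

definition grid_box :: "nat list \<Rightarrow> nat list \<Rightarrow> nat list \<Rightarrow> nat \<times> nat \<Rightarrow> (nat \<times> nat) set" where
  "grid_box w ts us = (\<lambda>(i, j). points_within w ((0 # ts @ [length w + 1]) ! i)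
     ((0 # ts @ [length w + 1]) ! (i + 1)) ((0 # us @ [length w + 1]) ! j) ((0 # us @ [length w + 1]) ! (j + 1)))"

lemma occurrence_iff:
  fixes w ts q :: "nat list"
  defines "us \<equiv> map (\<lambda>i. entry w (ts ! i)) q"
  assumes "mset q = mset [0..<length p]" "sorted_wrt (<) (map ((!) p) q)"
  shows "occurrence (p, R, D) w ts \<longleftrightarrow> length ts = length p \<and> set ts \<subseteq> {1..length w} \<and>
    sorted_wrt (<) ts \<and> sorted_wrt (<) us \<and> (\<forall>b\<in>R. grid_box w ts us b = {}) \<and>
    avoids_12 (\<Union>b\<in>D. grid_box w ts us b)"
proof (cases "length ts = length p \<and> sorted_wrt (<) us")
  case True
  then have "sort (map (entry w) ts) = us"
    using sort_map_nth[of q ts "entry w"] assms by simp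
  then have "box_points w ts = grid_box w ts us"
    by (auto simp: box_points_def grid_positions_def grid_values_def points_within_def grid_box_def)
  then show ?thesis
    using True order_isomorphic_iff[OF _ assms(2,3), of ts "entry w"]
    by (simp add: occurrence_def classical_occurrence_def us_def)
next
  case False
  then show ?thesis
    using order_isomorphic_iff[OF _ assms(2,3), of ts "entry w"]
    by (auto simp: occurrence_def classical_occurrence_def us_def)
qed

lemma contains_iff:
  assumes "mset q = mset [0..<length p]" "sorted_wrt (<) (map ((!) p) q)"
  shows "\<not> avoids w (p, R, D) \<longleftrightarrow> (\<exists>ts. length ts = length p \<and> set ts \<subseteq> {1..length w} \<and>
    sorted_wrt (<) ts \<and> sorted_wrt (<) (map (\<lambda>i. entry w (ts ! i)) q) \<and>
    (\<forall>b\<in>R. grid_box w ts (map (\<lambda>i. entry w (ts ! i)) q) b = {}) \<and>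
    avoids_12 (\<Union>b\<in>D. grid_box w ts (map (\<lambda>i. entry w (ts ! i)) q) b))"
  by (simp only: avoids_def not_not occurrence_iff[OF assms])

text \<open>The length is given through a literal list, here and in the next two lemmas, so that it
  matches \<open>length p\<close> for a concrete pattern \<open>p\<close>; the positions then become
  separate variables.\<close>

lemma ex_list5:
  "(\<exists>ts. length ts = length [y1, y2, y3, y4, y5] \<and> P ts) \<longleftrightarrow> (\<exists>x1 x2 x3 x4 x5. P [x1, x2, x3, x4, x5])" (is "?L = ?R")
proof
  assume ?L
  then obtain ts where "length ts = length [y1, y2, y3, y4, y5]" "P ts" by blast
  moreover from this obtain x1 x2 x3 x4 x5 where "ts = [x1, x2, x3, x4, x5]" by (auto simp: length_Suc_conv)
  ultimately show ?R by blast
next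
  assume ?R
  then obtain x1 x2 x3 x4 x5 where "P [x1, x2, x3, x4, x5]" by blast
  then show ?L by (intro exI[of _ "[x1, x2, x3, x4, x5]"]) simp
qed

lemma ex_list6:
  "(\<exists>ts. length ts = length [y1, y2, y3, y4, y5, y6] \<and> P ts) \<longleftrightarrow> (\<exists>x1 x2 x3 x4 x5 x6. P [x1, x2, x3, x4, x5, x6])" (is "?L = ?R")
proof
  assume ?L
  then obtain ts where "length ts = length [y1, y2, y3, y4, y5, y6]" "P ts" by blast
  moreover from this obtain x1 x2 x3 x4 x5 x6 where "ts = [x1, x2, x3, x4, x5, x6]" by (auto simp: length_Suc_conv)
  ultimately show ?R by blast
next
  assume ?R
  then obtain x1 x2 x3 x4 x5 x6 where "P [x1, x2, x3, x4, x5, x6]" by blast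
  then show ?L by (intro exI[of _ "[x1, x2, x3, x4, x5, x6]"]) simp
qed

lemma ex_list7:
  "(\<exists>ts. length ts = length [y1, y2, y3, y4, y5, y6, y7] \<and> P ts) \<longleftrightarrow> (\<exists>x1 x2 x3 x4 x5 x6 x7. P [x1, x2, x3, x4, x5, x6, x7])" (is "?L = ?R")
proof
  assume ?L
  then obtain ts where "length ts = length [y1, y2, y3, y4, y5, y6, y7]" "P ts" by blast
  moreover from this obtain x1 x2 x3 x4 x5 x6 x7 where "ts = [x1, x2, x3, x4, x5, x6, x7]" by (auto simp: length_Suc_conv)
  ultimately show ?R by blast
next
  assume ?R
  then obtain x1 x2 x3 x4 x5 x6 x7 where "P [x1, x2, x3, x4, x5, x6, x7]" by blast
  then show ?L by (intro exI[of _ "[x1, x2, x3, x4, x5, x6, x7]"]) simp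
qed

section \<open>Merging shaded boxes in a permutation\<close>

context
  fixes w :: "nat list"
  assumes distinct: "distinct w" and set: "set w = {1..length w}"
begin

lemma entry_less:
  assumes "x \<in> {1..length w}"
  shows "entry w x < length w + 1"
proof -
  have "x - 1 < length w" using assms by auto
  then have "w ! (x - 1) \<in> {1..length w}" using set nth_mem by blast
  then show ?thesis by (simp add: entry_def)
qed

lemma inj_on_entry: "inj_on (entry w) {1..length w}"
  using distinct by (auto simp: inj_on_def entry_def nth_eq_iff_index_eq)

text \<open>Only \<open>m\<close> has the height of the common side, and \<open>m\<close> lies
  outside the open column, so removing that side adds no point.\<close>

lemma points_within_merge:
  assumes "m \<in> {1..length w}" "m \<le> t \<or> t' \<le> m" "u \<le> entry w m" "entry w m \<le> u'"
  shows "points_within w t t' u (entry w m) = {} \<and> points_within w t t' (entry w m) u' = {} \<longleftrightarrow>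
    points_within w t t' u u' = {}"
proof -
  have "entry w x \<noteq> entry w m" if "x \<in> {1..length w}" "t < x" "x < t'" for x
    using inj_onD[OF inj_on_entry, of x m] that assms(1,2) by auto
  then show ?thesis
    unfolding points_within_empty_iff using assms(3,4) by (meson le_trans less_le_trans not_less order_le_less nat_neq_iff)
qed

text \<open>The trailing \<open>Q\<close> lets the rewriting act in the middle of a right-nested
  conjunction.\<close>

lemma points_within_merge':
  assumes "m \<in> {1..length w}" "m \<le> t \<or> t' \<le> m" "u \<le> entry w m" "entry w m \<le> u'"
  shows "points_within w t t' u (entry w m) = {} \<and> points_within w t t' (entry w m) u' = {} \<and> Q \<longleftrightarrow>
    points_within w t t' u u' = {} \<and> Q"
  using points_within_merge[OF assms] by blast

lemma points_within_top:
  "points_within w t t' u (length w + 1) = {} \<longleftrightarrow> (\<forall>x\<in>{1..length w}. t < x \<and> x < t' \<longrightarrow> entry w x \<le> u)"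
  unfolding points_within_empty_iff using entry_less by (meson not_less)

text \<open>The removed vertical side carries only the point at \<open>m\<close>, which is not above
  \<open>u\<close>. This serves \<open>pat_I4\<close>, where the entry 2 cuts the shaded region
  between 4 and 3.\<close>

lemma points_within_merge_columns:
  assumes "entry w m \<le> u" "t < m" "m < t'"
  shows "points_within w t m u u' = {} \<and> points_within w m t' u u' = {} \<longleftrightarrow> points_within w t t' u u' = {}"
proof (unfold points_within_empty_iff, intro iffI ballI impI conjI)
  fix x
  assume "(\<forall>x\<in>{1..length w}. t < x \<and> x < m \<and> u < entry w x \<longrightarrow> u' \<le> entry w x) \<and>
    (\<forall>x\<in>{1..length w}. m < x \<and> x < t' \<and> u < entry w x \<longrightarrow> u' \<le> entry w x)"
    and "x \<in> {1..length w}" "t < x \<and> x < t' \<and> u < entry w x"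
  then show "u' \<le> entry w x"
    using assms by (cases x m rule: linorder_cases) auto
qed (use assms in \<open>meson less_trans\<close>)+

lemma not_overtaken_iff:
  "\<not> overtaken {1..length w} (entry w) x y \<longleftrightarrow> points_within w x y (entry w x) (length w + 1) = {}"
  unfolding overtaken_def points_within_top not_less[symmetric] by blast

section \<open>The ten patterns expressed through positions and \<open>overtaken\<close>\<close>

lemmas contains_simps = grid_box_def sorted_wrt2 sorted_wrt1 entry_less entry_less[THEN less_imp_le]
  points_within_merge points_within_merge'
  not_overtaken_iff avoids_12_empty Bex_def

lemma contains_I1:
  "\<not> avoids w pat_I1 \<longleftrightarrow> (\<exists>b c d e a. {b, c, d, e, a} \<subseteq> {1..length w} \<and>
     b < c \<and> c < d \<and> d < e \<and> e < a \<and>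
     entry w a < entry w b \<and> entry w b < entry w c \<and> entry w c < entry w d \<and> entry w d < entry w e)"
  unfolding pat_I1_def
  \<comment> \<open>\<open>q\<close> gives the indices, counted from 0, at which the pattern carries
    the values 1 to 5.\<close>
  by (subst contains_iff[where q = "[4, 0, 1, 2, 3]"],
    simp add: upt_conv_Cons numeral_eq_Suc, simp, subst ex_list5,
    simp add: contains_simps cong: conj_cong del: sorted_wrt.simps One_nat_def atLeastAtMost_iff)

lemma contains_I2:
  "\<not> avoids w pat_I2 \<longleftrightarrow> (\<exists>b d c e a. {b, d, c, e, a} \<subseteq> {1..length w} \<and>
     b < d \<and> d < c \<and> c < e \<and> e < a \<and>
     entry w a < entry w b \<and> entry w b < entry w c \<and> entry w c < entry w d \<and> entry w d < entry w e \<and>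
     \<not> overtaken {1..length w} (entry w) d c)"
  unfolding pat_I2_def
  by (subst contains_iff[where q = "[4, 0, 2, 1, 3]"],
    simp add: upt_conv_Cons numeral_eq_Suc, simp, subst ex_list5,
    simp add: contains_simps cong: conj_cong del: sorted_wrt.simps One_nat_def atLeastAtMost_iff)

lemma contains_I3:
  "\<not> avoids w pat_I3 \<longleftrightarrow> (\<exists>c b d e a. {c, b, d, e, a} \<subseteq> {1..length w} \<and>
     c < b \<and> b < d \<and> d < e \<and> e < a \<and>
     entry w a < entry w b \<and> entry w b < entry w c \<and> entry w c < entry w d \<and> entry w d < entry w e \<and>
     \<not> overtaken {1..length w} (entry w) c b)"
  unfolding pat_I3_def
  by (subst contains_iff[where q = "[4, 1, 0, 2, 3]"],
    simp add: upt_conv_Cons numeral_eq_Suc, simp, subst ex_list5,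
    simp add: contains_simps cong: conj_cong del: sorted_wrt.simps One_nat_def atLeastAtMost_iff)

lemma contains_I4:
  "\<not> avoids w pat_I4 \<longleftrightarrow> (\<exists>d b c e a. {d, b, c, e, a} \<subseteq> {1..length w} \<and>
     d < b \<and> b < c \<and> c < e \<and> e < a \<and>
     entry w a < entry w b \<and> entry w b < entry w c \<and> entry w c < entry w d \<and> entry w d < entry w e \<and>
     \<not> overtaken {1..length w} (entry w) d c)"
  unfolding pat_I4_def
  by (subst contains_iff[where q = "[4, 1, 2, 0, 3]"],
    simp add: upt_conv_Cons numeral_eq_Suc, simp, subst ex_list5,
    simp add: contains_simps points_within_merge_columns cong: conj_cong del: sorted_wrt.simps One_nat_def atLeastAtMost_iff)

lemma contains_I5:
  "\<not> avoids w pat_I5 \<longleftrightarrow> (\<exists>d c b e a. {d, c, b, e, a} \<subseteq> {1..length w} \<and>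
     d < c \<and> c < b \<and> b < e \<and> e < a \<and>
     entry w a < entry w b \<and> entry w b < entry w c \<and> entry w c < entry w d \<and> entry w d < entry w e \<and>
     \<not> overtaken {1..length w} (entry w) d c \<and>
     \<not> overtaken {1..length w} (entry w) c b)"
  unfolding pat_I5_def
  by (subst contains_iff[where q = "[4, 2, 1, 0, 3]"],
    simp add: upt_conv_Cons numeral_eq_Suc, simp, subst ex_list5,
    simp add: contains_simps cong: conj_cong del: sorted_wrt.simps One_nat_def atLeastAtMost_iff)

lemma contains_J2_12:
  "\<not> avoids w pat_J2_12 \<longleftrightarrow> (\<exists>c d b e a. {c, d, b, e, a} \<subseteq> {1..length w} \<and>
     c < d \<and> d < b \<and> b < e \<and> e < a \<and>
     entry w a < entry w b \<and> entry w b < entry w c \<and> entry w c < entry w d \<and> entry w d < entry w e \<and>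
     \<not> overtaken {1..length w} (entry w) c d \<and>
     \<not> overtaken {1..length w} (entry w) d b)"
  unfolding pat_J2_12_def
  by (subst contains_iff[where q = "[4, 2, 0, 1, 3]"],
    simp add: upt_conv_Cons numeral_eq_Suc, simp, subst ex_list5,
    simp add: contains_simps cong: conj_cong del: sorted_wrt.simps One_nat_def atLeastAtMost_iff)

text \<open>In the column from \<open>f\<close> to \<open>b\<close> the band between
  \<open>e\<close> and \<open>f\<close> is decorated rather than shaded, so the shading there splits
  into the band from \<open>d\<close> to \<open>e\<close> and the region above
  \<open>f\<close>.\<close>

lemma contains_J1_10:
  "\<not> avoids w pat_J1_10 \<longleftrightarrow> (\<exists>c f b d e a. {c, f, b, d, e, a} \<subseteq> {1..length w} \<and>
     c < f \<and> f < b \<and> b < d \<and> d < e \<and> e < a \<and>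
     entry w a < entry w b \<and> entry w b < entry w c \<and> entry w c < entry w d \<and> entry w d < entry w e \<and> entry w e < entry w f \<and>
     points_within w 0 c (entry w d) (entry w f) = {} \<and>
     \<not> overtaken {1..length w} (entry w) c f \<and>
     points_within w f b (entry w d) (entry w e) = {} \<and>
     \<not> overtaken {1..length w} (entry w) f b \<and>
     avoids_12 (points_within w f b (entry w e) (entry w f)))"
  unfolding pat_J1_10_def
  by (subst contains_iff[where q = "[5, 2, 0, 3, 4, 1]"],
    simp add: upt_conv_Cons numeral_eq_Suc, simp, subst ex_list6,
    simp add: contains_simps cong: conj_cong del: sorted_wrt.simps One_nat_def atLeastAtMost_iff)

lemma contains_J2_10:
  "\<not> avoids w pat_J2_10 \<longleftrightarrow> (\<exists>c f d b e a. {c, f, d, b, e, a} \<subseteq> {1..length w} \<and>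
     c < f \<and> f < d \<and> d < b \<and> b < e \<and> e < a \<and>
     entry w a < entry w b \<and> entry w b < entry w c \<and> entry w c < entry w d \<and> entry w d < entry w e \<and> entry w e < entry w f \<and>
     points_within w 0 c (entry w d) (entry w f) = {} \<and>
     \<not> overtaken {1..length w} (entry w) c f \<and>
     points_within w f d (entry w d) (entry w e) = {} \<and>
     \<not> overtaken {1..length w} (entry w) f d \<and>
     \<not> overtaken {1..length w} (entry w) d b \<and>
     avoids_12 (points_within w f d (entry w e) (entry w f)))"
  unfolding pat_J2_10_def
  by (subst contains_iff[where q = "[5, 3, 0, 2, 4, 1]"],
    simp add: upt_conv_Cons numeral_eq_Suc, simp, subst ex_list6,
    simp add: contains_simps cong: conj_cong del: sorted_wrt.simps One_nat_def atLeastAtMost_iff)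

text \<open>The entry 7 at \<open>g\<close> replaces the empty bands left of \<open>c\<close>: now
  the strip between \<open>g\<close> and \<open>c\<close> above \<open>d\<close> is empty.\<close>

lemma contains_J1_11:
  "\<not> avoids w pat_J1_11 \<longleftrightarrow> (\<exists>g c f b d e a. {g, c, f, b, d, e, a} \<subseteq> {1..length w} \<and>
     g < c \<and> c < f \<and> f < b \<and> b < d \<and> d < e \<and> e < a \<and>
     entry w a < entry w b \<and> entry w b < entry w c \<and> entry w c < entry w d \<and> entry w d < entry w e \<and> entry w e < entry w f \<and> entry w f < entry w g \<and>
     points_within w g c (entry w d) (length w + 1) = {} \<and>
     \<not> overtaken {1..length w} (entry w) c f \<and>
     points_within w f b (entry w d) (entry w e) = {} \<and>
     \<not> overtaken {1..length w} (entry w) f b \<and>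
     avoids_12 (points_within w f b (entry w e) (entry w f)))"
  unfolding pat_J1_11_def
  by (subst contains_iff[where q = "[6, 3, 1, 4, 5, 2, 0]"],
    simp add: upt_conv_Cons numeral_eq_Suc, simp, subst ex_list7,
    simp add: contains_simps cong: conj_cong del: sorted_wrt.simps One_nat_def atLeastAtMost_iff)

lemma contains_J2_11:
  "\<not> avoids w pat_J2_11 \<longleftrightarrow> (\<exists>g c f d b e a. {g, c, f, d, b, e, a} \<subseteq> {1..length w} \<and>
     g < c \<and> c < f \<and> f < d \<and> d < b \<and> b < e \<and> e < a \<and>
     entry w a < entry w b \<and> entry w b < entry w c \<and> entry w c < entry w d \<and> entry w d < entry w e \<and> entry w e < entry w f \<and> entry w f < entry w g \<and>
     points_within w g c (entry w d) (length w + 1) = {} \<and>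
     \<not> overtaken {1..length w} (entry w) c f \<and>
     points_within w f d (entry w d) (entry w e) = {} \<and>
     \<not> overtaken {1..length w} (entry w) f d \<and>
     \<not> overtaken {1..length w} (entry w) d b \<and>
     avoids_12 (points_within w f d (entry w e) (entry w f)))"
  unfolding pat_J2_11_def
  by (subst contains_iff[where q = "[6, 4, 1, 3, 5, 2, 0]"],
    simp add: upt_conv_Cons numeral_eq_Suc, simp, subst ex_list7,
    simp add: contains_simps cong: conj_cong del: sorted_wrt.simps One_nat_def atLeastAtMost_iff)

section \<open>Configurations as pattern containment\<close>

lemma contains_I_iff:
  "contains_I {1..length w} (entry w) \<longleftrightarrow>
    \<not> avoids w pat_I1 \<or> \<not> avoids w pat_I2 \<or> \<not> avoids w pat_I3 \<or> \<not> avoids w pat_I4 \<or> \<not> avoids w pat_I5"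
  (is "?L \<longleftrightarrow> ?R")
proof
  assume ?L
  then obtain a b c d e where A: "a \<in> {1..length w}" "b \<in> {1..length w}" "c \<in> {1..length w}"
      "d \<in> {1..length w}" "e \<in> {1..length w}" and "e < a"
    and v: "entry w a < entry w b" "entry w b < entry w c" "entry w c < entry w d" "entry w d < entry w e"
    and "b < c \<and> c < d \<and> d < e \<or>
      b < d \<and> d < c \<and> c < e \<and> \<not> overtaken {1..length w} (entry w) d c \<or>
      c < b \<and> b < d \<and> d < e \<and> \<not> overtaken {1..length w} (entry w) c b \<or>
      d < b \<and> b < c \<and> c < e \<and> \<not> overtaken {1..length w} (entry w) d c \<or>
      d < c \<and> c < b \<and> b < e \<and> \<not> overtaken {1..length w} (entry w) d c \<and>
        \<not> overtaken {1..length w} (entry w) c b" (is "?c1 \<or> ?c2 \<or> ?c3 \<or> ?c4 \<or> ?c5")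
    unfolding contains_I_def by blast
  then consider ?c1 | ?c2 | ?c3 | ?c4 | ?c5 by argo
  then show ?R
  proof cases
    case 1
    then have "\<not> avoids w pat_I1" unfolding contains_I1
      using A v \<open>e < a\<close>
      by - (rule exI[of _ b], rule exI[of _ c], rule exI[of _ d], rule exI[of _ e], rule exI[of _ a], simp)
    then show ?thesis by simp
  next
    case 2
    then have "\<not> avoids w pat_I2" unfolding contains_I2
      using A v \<open>e < a\<close>
      by - (rule exI[of _ b], rule exI[of _ d], rule exI[of _ c], rule exI[of _ e], rule exI[of _ a], simp)
    then show ?thesis by simp
  next
    case 3
    then have "\<not> avoids w pat_I3" unfolding contains_I3
      using A v \<open>e < a\<close>
      by - (rule exI[of _ c], rule exI[of _ b], rule exI[of _ d], rule exI[of _ e], rule exI[of _ a], simp)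
    then show ?thesis by simp
  next
    case 4
    then have "\<not> avoids w pat_I4" unfolding contains_I4
      using A v \<open>e < a\<close>
      by - (rule exI[of _ d], rule exI[of _ b], rule exI[of _ c], rule exI[of _ e], rule exI[of _ a], simp)
    then show ?thesis by simp
  next
    case 5
    then have "\<not> avoids w pat_I5" unfolding contains_I5
      using A v \<open>e < a\<close>
      by - (rule exI[of _ d], rule exI[of _ c], rule exI[of _ b], rule exI[of _ e], rule exI[of _ a], simp)
    then show ?thesis by simp
  qed
next
  have I: "contains_I {1..length w} (entry w)"
    if "{a, b, c, d, e} \<subseteq> {1..length w}" "e < a"
      "entry w a < entry w b" "entry w b < entry w c" "entry w c < entry w d" "entry w d < entry w e"
      "b < c \<and> c < d \<and> d < e \<or>
      b < d \<and> d < c \<and> c < e \<and> \<not> overtaken {1..length w} (entry w) d c \<or>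
      c < b \<and> b < d \<and> d < e \<and> \<not> overtaken {1..length w} (entry w) c b \<or>
      d < b \<and> b < c \<and> c < e \<and> \<not> overtaken {1..length w} (entry w) d c \<or>
      d < c \<and> c < b \<and> b < e \<and> \<not> overtaken {1..length w} (entry w) d c \<and>
        \<not> overtaken {1..length w} (entry w) c b" for a b c d e
    unfolding contains_I_def
    by (rule bexI[of _ a], rule bexI[of _ b], rule bexI[of _ c], rule bexI[of _ d], rule bexI[of _ e])
      (use that in simp_all)
  assume ?R
  then consider "\<not> avoids w pat_I1" | "\<not> avoids w pat_I2" | "\<not> avoids w pat_I3"
    | "\<not> avoids w pat_I4" | "\<not> avoids w pat_I5" by argo
  then show ?L
  proof cases
    case 1
    then obtain b c d e a where "{a, b, c, d, e} \<subseteq> {1..length w}" "e < a"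
      "entry w a < entry w b" "entry w b < entry w c" "entry w c < entry w d" "entry w d < entry w e"
      "b < c" "c < d" "d < e"
      unfolding contains_I1 insert_subset by blast
    then show ?thesis by (intro I[of a b c d e]) simp_all
  next
    case 2
    then obtain b d c e a where "{a, b, c, d, e} \<subseteq> {1..length w}" "e < a"
      "entry w a < entry w b" "entry w b < entry w c" "entry w c < entry w d" "entry w d < entry w e"
      "b < d" "d < c" "c < e" "\<not> overtaken {1..length w} (entry w) d c"
      unfolding contains_I2 insert_subset by blast
    then show ?thesis by (intro I[of a b c d e]) simp_all
  next
    case 3
    then obtain c b d e a where "{a, b, c, d, e} \<subseteq> {1..length w}" "e < a"
      "entry w a < entry w b" "entry w b < entry w c" "entry w c < entry w d" "entry w d < entry w e"
      "c < b" "b < d" "d < e" "\<not> overtaken {1..length w} (entry w) c b"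
      unfolding contains_I3 insert_subset by blast
    then show ?thesis by (intro I[of a b c d e]) simp_all
  next
    case 4
    then obtain d b c e a where "{a, b, c, d, e} \<subseteq> {1..length w}" "e < a"
      "entry w a < entry w b" "entry w b < entry w c" "entry w c < entry w d" "entry w d < entry w e"
      "d < b" "b < c" "c < e" "\<not> overtaken {1..length w} (entry w) d c"
      unfolding contains_I4 insert_subset by blast
    then show ?thesis by (intro I[of a b c d e]) simp_all
  next
    case 5
    then obtain d c b e a where "{a, b, c, d, e} \<subseteq> {1..length w}" "e < a"
      "entry w a < entry w b" "entry w b < entry w c" "entry w c < entry w d" "entry w d < entry w e"
      "d < c" "c < b" "b < e" "\<not> overtaken {1..length w} (entry w) d c" "\<not> overtaken {1..length w} (entry w) c b"
      unfolding contains_I5 insert_subset by blast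
    then show ?thesis by (intro I[of a b c d e]) simp_all
  qed
qed

lemma crest_iff:
  "(\<exists>c d b e a. crest {1..length w} (entry w) a b c d e) \<longleftrightarrow> \<not> avoids w pat_J2_12"
proof -
  have *: "crest {1..length w} (entry w) a b c d e \<longleftrightarrow> {c, d, b, e, a} \<subseteq> {1..length w} \<and>
     c < d \<and> d < b \<and> b < e \<and> e < a \<and> entry w a < entry w b \<and> entry w b < entry w c \<and>
     entry w c < entry w d \<and> entry w d < entry w e \<and>
     \<not> overtaken {1..length w} (entry w) c d \<and> \<not> overtaken {1..length w} (entry w) d b" for a b c d e
    unfolding crest_def not_overtaken_iff points_within_top
    by (simp del: atLeastAtMost_iff One_nat_def) argo
  then show ?thesis
    unfolding contains_J2_12 by (simp only: *)
qed

text \<open>For the forward direction take \<open>g\<close> to be the last entry before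
  \<open>c\<close> that is above \<open>f\<close>: an entry above \<open>d\<close> between
  \<open>g\<close> and \<open>c\<close> would force a later such \<open>g\<close>. The two
  alternatives separate the \<open>10\<close>-patterns from the \<open>11\<close>-patterns.\<close>

lemma protected_iff:
  assumes "f \<in> {1..length w}" "c < f" "entry w d < entry w f"
  shows "(\<forall>x\<in>{1..length w}. x < c \<and> entry w d < entry w x \<and> entry w x < entry w f \<longrightarrow>
      (\<exists>g\<in>{1..length w}. x < g \<and> g < c \<and> entry w f < entry w g)) \<longleftrightarrow>
    points_within w 0 c (entry w d) (entry w f) = {} \<or>
    (\<exists>g\<in>{1..length w}. g < c \<and> entry w f < entry w g \<and>
      points_within w g c (entry w d) (length w + 1) = {})" (is "?L \<longleftrightarrow> ?E \<or> ?G")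
proof
  assume L: ?L
  show "?E \<or> ?G"
  proof (cases ?E)
    case False
    then obtain x where x: "x \<in> {1..length w}" "x < c" "entry w d < entry w x" "entry w x < entry w f"
      unfolding points_within_empty_iff not_less[symmetric] by blast
    let ?B = "{g \<in> {1..length w}. g < c \<and> entry w f < entry w g}"
    have B: "finite ?B" "?B \<noteq> {}" using L x by (simp, blast)
    have "entry w y \<le> entry w d" if y: "y \<in> {1..length w}" "Max ?B < y" "y < c" for y
    proof (rule ccontr)
      assume d: "\<not> entry w y \<le> entry w d"
      have no: "z \<notin> ?B" if "Max ?B < z" for z using that B(1) by (meson Max_ge leD)
      have "entry w y \<noteq> entry w f"
        using inj_onD[OF inj_on_entry, of y f] y assms by auto
      moreover have "\<not> entry w f < entry w y" using no[of y] y by blast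
      ultimately have "entry w y < entry w f" by simp
      then obtain g where "g \<in> {1..length w}" "y < g" "g < c" "entry w f < entry w g"
        using L y d by (meson not_le)
      then show False using no[of g] y by simp
    qed
    then have ?G using Max_in[OF B] unfolding points_within_top by blast
    then show ?thesis ..
  qed simp
next
  assume "?E \<or> ?G"
  then show ?L
  proof
    assume ?E
    then show ?L unfolding points_within_empty_iff by fastforce
  next
    assume ?G
    then obtain g where g: "g \<in> {1..length w}" "g < c" "entry w f < entry w g"
      "\<forall>x\<in>{1..length w}. g < x \<and> x < c \<longrightarrow> entry w x \<le> entry w d"
      unfolding points_within_top by blast
    have "x < g" if "x \<in> {1..length w}" "x < c" "entry w d < entry w x" "entry w x < entry w f" for x
      using g that by (cases x g rule: linorder_cases) auto
    then show ?L using g(1-3) by blast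
  qed
qed

text \<open>Collects the conditions on the column right of \<open>f\<close>. Its end
  \<open>t\<close> is \<open>b\<close> in \<open>pat_J1_10\<close> and \<open>pat_J1_11\<close>, and
  \<open>d\<close> in \<open>pat_J2_10\<close> and \<open>pat_J2_11\<close>.\<close>

definition staircase :: "nat \<Rightarrow> nat \<Rightarrow> nat \<Rightarrow> nat \<Rightarrow> bool" where
  "staircase d e f t \<longleftrightarrow> points_within w f t (entry w d) (entry w e) = {} \<and> \<not> overtaken {1..length w} (entry w) f t \<and>
     avoids_12 (points_within w f t (entry w e) (entry w f))"

text \<open>If \<open>f\<close> is not overtaken, injectivity makes every entry of the column
  strictly lower than \<open>f\<close>, so the decorated box consists of all entries of the column
  above \<open>e\<close>.\<close>

lemma staircase_iff:
  assumes "f \<in> {1..length w}"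
  shows "staircase d e f t \<longleftrightarrow>
    (\<forall>x\<in>{1..length w}. f < x \<and> x < t \<longrightarrow> entry w x \<le> entry w f \<and> \<not> (entry w d < entry w x \<and> entry w x < entry w e)) \<and>
    (\<forall>x\<in>{1..length w}. \<forall>y\<in>{1..length w}. f < x \<and> x < y \<and> y < t \<and> entry w e < entry w x \<longrightarrow> entry w y \<le> entry w x)"
    (is "_ \<longleftrightarrow> ?H \<and> ?D")
proof -
  have "points_within w f t (entry w d) (entry w e) = {} \<longleftrightarrow>
      (\<forall>x\<in>{1..length w}. f < x \<and> x < t \<longrightarrow> \<not> (entry w d < entry w x \<and> entry w x < entry w e))"
    unfolding points_within_empty_iff by (meson not_less)
  moreover have "\<not> overtaken {1..length w} (entry w) f t \<longleftrightarrow> (\<forall>x\<in>{1..length w}. f < x \<and> x < t \<longrightarrow> entry w x \<le> entry w f)"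
    by (simp only: not_overtaken_iff points_within_top)
  ultimately have *: "staircase d e f t \<longleftrightarrow> ?H \<and> avoids_12 (points_within w f t (entry w e) (entry w f))"
    unfolding staircase_def by blast
  have "avoids_12 (points_within w f t (entry w e) (entry w f)) \<longleftrightarrow> ?D" if h: ?H
  proof -
    have "entry w y < entry w f" if "y \<in> {1..length w}" "f < y" "y < t" for y
      using that h inj_onD[OF inj_on_entry, of y f] assms
      by (metis less_irrefl order_le_less)
    then show ?thesis
      unfolding avoids_12_points_within_iff by (meson less_trans)
  qed
  then show ?thesis unfolding * by blast
qed

text \<open>As \<open>d\<close> is not overtaken before \<open>b\<close>, the entries from
  \<open>d\<close> to just before \<open>b\<close> are at most \<open>d\<close>, hence below
  \<open>e\<close> and \<open>f\<close>, and meet every staircase condition.\<close>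

lemma staircase_shorten:
  assumes "f \<in> {1..length w}" "f < d" "d < b" "d \<in> {1..length w}" "entry w d < entry w e" "entry w e < entry w f"
    "\<not> overtaken {1..length w} (entry w) d b"
  shows "staircase d e f b \<longleftrightarrow> staircase d e f d"
proof
  assume "staircase d e f b"
  then show "staircase d e f d"
    using assms(3) unfolding staircase_iff[OF assms(1)] by (meson less_trans)
next
  assume s: "staircase d e f d"
  have low: "entry w x \<le> entry w d" if "x \<in> {1..length w}" "d \<le> x" "x < b" for x
    using assms(7) that unfolding overtaken_def by (cases "x = d") (auto simp del: One_nat_def atLeastAtMost_iff simp: not_less)
  have "x < d" if "x \<in> {1..length w}" "x < b" "entry w d < entry w x" for x
    using low[of x] that by (meson not_le)
  moreover have "entry w y \<le> entry w x" if "x \<in> {1..length w}" "y \<in> {1..length w}" "d \<le> y" "y < b" "entry w e < entry w x" for x y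
    using low[of y] that assms(5) by linarith
  moreover have "entry w x \<le> entry w f" if "x \<in> {1..length w}" "d \<le> x" "x < b" for x
    using low[of x] that assms(5,6) by linarith
  ultimately show "staircase d e f b"
    using s unfolding staircase_iff[OF assms(1)] by (meson not_le)
qed

lemma high_crest_eq:
  "high_crest {1..length w} (entry w) a b c d e f \<longleftrightarrow>
    {c, f, b, d, e, a} \<subseteq> {1..length w} \<and>
    (c < f \<and> f < b \<and> f < d \<and> d \<noteq> b \<and> b < e \<and> d < e \<and> e < a \<and>
    entry w a < entry w b \<and> entry w b < entry w c \<and> entry w c < entry w d \<and>
    entry w d < entry w e \<and> entry w e < entry w f) \<and>
    \<not> overtaken {1..length w} (entry w) c f \<and> staircase d e f b \<and> (d < b \<longrightarrow> \<not> overtaken {1..length w} (entry w) d b) \<and>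
    (points_within w 0 c (entry w d) (entry w f) = {} \<or> (\<exists>g\<in>{1..length w}. g < c \<and> entry w f < entry w g \<and> points_within w g c (entry w d) (length w + 1) = {}))"
    (is "_ \<longleftrightarrow> ?in \<and> ?order \<and> ?cf \<and> ?fb \<and> ?db \<and> ?left")
proof (cases "?in \<and> ?order")
  case True
  then have f: "f \<in> {1..length w}" and cf: "c < f" by simp_all
  have df: "entry w d < entry w f" using True by (meson less_trans)
  have db: "?db \<longleftrightarrow> (\<forall>x\<in>{1..length w}. d < x \<and> x < b \<longrightarrow> entry w x \<le> entry w d)"
    unfolding not_overtaken_iff points_within_top by (meson less_trans)
  show ?thesis
    unfolding high_crest_def db staircase_iff[OF f] protected_iff[OF f cf df, symmetric]
    unfolding not_overtaken_iff points_within_top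
    using True by (simp del: atLeastAtMost_iff One_nat_def)
next
  case False
  then show ?thesis unfolding high_crest_def by (simp del: atLeastAtMost_iff One_nat_def) argo
qed

text \<open>Two independent alternatives give the four patterns: \<open>b\<close> before or after
  \<open>d\<close> selects \<open>J1\<close> or \<open>J2\<close>, and the disjunction of
  \<open>protected_iff\<close> selects \<open>10\<close> or \<open>11\<close>.\<close>

lemma high_crest_iff:
  "(\<exists>c f b d e a. high_crest {1..length w} (entry w) a b c d e f) \<longleftrightarrow>
    \<not> avoids w pat_J1_10 \<or> \<not> avoids w pat_J2_10 \<or> \<not> avoids w pat_J1_11 \<or> \<not> avoids w pat_J2_11"
  (is "?L \<longleftrightarrow> ?R")
proof
  assume ?L
  then obtain a b c d e f where h: "high_crest {1..length w} (entry w) a b c d e f" by blast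
  then have A: "{c, f, b, d, e, a} \<subseteq> {1..length w}"
    and o: "c < f" "f < b" "f < d" "d \<noteq> b" "b < e" "d < e" "e < a"
      "entry w a < entry w b" "entry w b < entry w c" "entry w c < entry w d"
      "entry w d < entry w e" "entry w e < entry w f"
    and cf: "\<not> overtaken {1..length w} (entry w) c f" and fb: "staircase d e f b" and db: "d < b \<longrightarrow> \<not> overtaken {1..length w} (entry w) d b"
    and left: "points_within w 0 c (entry w d) (entry w f) = {} \<or>
      (\<exists>g\<in>{1..length w}. g < c \<and> entry w f < entry w g \<and> points_within w g c (entry w d) (length w + 1) = {})"
    unfolding high_crest_eq by blast+
  have fd: "staircase d e f d" if "d < b"
    using staircase_shorten[of f d b e] A o db fb that by simp
  show ?R
  proof (cases "b < d")
    case True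
    from left show ?thesis
    proof (elim disjE bexE conjE)
      assume "points_within w 0 c (entry w d) (entry w f) = {}"
      then have "\<not> avoids w pat_J1_10"
        unfolding contains_J1_10 using A o cf fb True
        by - (rule exI[of _ c], rule exI[of _ f], rule exI[of _ b], rule exI[of _ d], rule exI[of _ e],
          rule exI[of _ a], simp add: staircase_def)
      then show ?thesis by simp
    next
      fix g assume "g \<in> {1..length w}" "g < c" "entry w f < entry w g" "points_within w g c (entry w d) (length w + 1) = {}"
      then have "\<not> avoids w pat_J1_11"
        unfolding contains_J1_11 using A o cf fb True
        by - (rule exI[of _ g], rule exI[of _ c], rule exI[of _ f], rule exI[of _ b], rule exI[of _ d],
          rule exI[of _ e], rule exI[of _ a], simp add: staircase_def)
      then show ?thesis by simp
    qed
  next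
    case False
    then have "d < b" using o by simp
    from left show ?thesis
    proof (elim disjE bexE conjE)
      assume "points_within w 0 c (entry w d) (entry w f) = {}"
      then have "\<not> avoids w pat_J2_10"
        unfolding contains_J2_10 using A o cf fd db \<open>d < b\<close>
        by - (rule exI[of _ c], rule exI[of _ f], rule exI[of _ d], rule exI[of _ b], rule exI[of _ e],
          rule exI[of _ a], simp add: staircase_def)
      then show ?thesis by simp
    next
      fix g assume "g \<in> {1..length w}" "g < c" "entry w f < entry w g" "points_within w g c (entry w d) (length w + 1) = {}"
      then have "\<not> avoids w pat_J2_11"
        unfolding contains_J2_11 using A o cf fd db \<open>d < b\<close>
        by - (rule exI[of _ g], rule exI[of _ c], rule exI[of _ f], rule exI[of _ d], rule exI[of _ b],
          rule exI[of _ e], rule exI[of _ a], simp add: staircase_def)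
      then show ?thesis by simp
    qed
  qed
next
  assume ?R
  then consider "\<not> avoids w pat_J1_10" | "\<not> avoids w pat_J2_10" | "\<not> avoids w pat_J1_11"
    | "\<not> avoids w pat_J2_11" by argo
  then show ?L
  proof cases
    case 1
    then obtain c f b d e a where A: "{c, f, b, d, e, a} \<subseteq> {1..length w}"
      and o: "c < f" "f < b" "b < d" "d < e" "e < a" "entry w a < entry w b" "entry w b < entry w c" "entry w c < entry w d" "entry w d < entry w e" "entry w e < entry w f"
      and left: "points_within w 0 c (entry w d) (entry w f) = {}" and cf: "\<not> overtaken {1..length w} (entry w) c f"
      and stair: "points_within w f b (entry w d) (entry w e) = {}" "\<not> overtaken {1..length w} (entry w) f b" "avoids_12 (points_within w f b (entry w e) (entry w f))"
      unfolding contains_J1_10 by (elim exE conjE) (rule that, assumption+)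
    have fb: "staircase d e f b" unfolding staircase_def using stair by simp
    with A o cf fb left have "high_crest {1..length w} (entry w) a b c d e f"
      unfolding high_crest_eq by (simp del: atLeastAtMost_iff One_nat_def)
    then show ?thesis by blast
  next
    case 2
    then obtain c f d b e a where A: "{c, f, d, b, e, a} \<subseteq> {1..length w}"
      and o: "c < f" "f < d" "d < b" "b < e" "e < a" "entry w a < entry w b" "entry w b < entry w c" "entry w c < entry w d" "entry w d < entry w e" "entry w e < entry w f"
      and left: "points_within w 0 c (entry w d) (entry w f) = {}" and cf: "\<not> overtaken {1..length w} (entry w) c f"
      and stair: "points_within w f d (entry w d) (entry w e) = {}" "\<not> overtaken {1..length w} (entry w) f d" "\<not> overtaken {1..length w} (entry w) d b" "avoids_12 (points_within w f d (entry w e) (entry w f))"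
      unfolding contains_J2_10 by (elim exE conjE) (rule that, assumption+)
    have "staircase d e f d" unfolding staircase_def using stair by simp
    then have fb: "staircase d e f b" using staircase_shorten[of f d b e] A o stair(3) by simp
    with A o cf fb stair(3) left have "high_crest {1..length w} (entry w) a b c d e f"
      unfolding high_crest_eq by (simp del: atLeastAtMost_iff One_nat_def)
    then show ?thesis by blast
  next
    case 3
    then obtain g c f b d e a where A: "{g, c, f, b, d, e, a} \<subseteq> {1..length w}"
      and o: "g < c" "c < f" "f < b" "b < d" "d < e" "e < a" "entry w a < entry w b" "entry w b < entry w c" "entry w c < entry w d" "entry w d < entry w e" "entry w e < entry w f" "entry w f < entry w g"
      and left: "points_within w g c (entry w d) (length w + 1) = {}" and cf: "\<not> overtaken {1..length w} (entry w) c f"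
      and stair: "points_within w f b (entry w d) (entry w e) = {}" "\<not> overtaken {1..length w} (entry w) f b" "avoids_12 (points_within w f b (entry w e) (entry w f))"
      unfolding contains_J1_11 by (elim exE conjE) (rule that, assumption+)
    have fb: "staircase d e f b" unfolding staircase_def using stair by simp
    have "\<exists>g\<in>{1..length w}. g < c \<and> entry w f < entry w g \<and> points_within w g c (entry w d) (length w + 1) = {}"
      using A o left by (intro bexI[of _ g]) simp_all
    with A o cf fb have "high_crest {1..length w} (entry w) a b c d e f"
      unfolding high_crest_eq by (simp del: atLeastAtMost_iff One_nat_def)
    then show ?thesis by blast
  next
    case 4
    then obtain g c f d b e a where A: "{g, c, f, d, b, e, a} \<subseteq> {1..length w}"
      and o: "g < c" "c < f" "f < d" "d < b" "b < e" "e < a" "entry w a < entry w b" "entry w b < entry w c" "entry w c < entry w d" "entry w d < entry w e" "entry w e < entry w f" "entry w f < entry w g"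
      and left: "points_within w g c (entry w d) (length w + 1) = {}" and cf: "\<not> overtaken {1..length w} (entry w) c f"
      and stair: "points_within w f d (entry w d) (entry w e) = {}" "\<not> overtaken {1..length w} (entry w) f d" "\<not> overtaken {1..length w} (entry w) d b" "avoids_12 (points_within w f d (entry w e) (entry w f))"
      unfolding contains_J2_11 by (elim exE conjE) (rule that, assumption+)
    have "staircase d e f d" unfolding staircase_def using stair by simp
    then have fb: "staircase d e f b" using staircase_shorten[of f d b e] A o stair(3) by simp
    have "\<exists>g\<in>{1..length w}. g < c \<and> entry w f < entry w g \<and> points_within w g c (entry w d) (length w + 1) = {}"
      using A o left by (intro bexI[of _ g]) simp_all
    with A o cf fb stair(3) have "high_crest {1..length w} (entry w) a b c d e f"
      unfolding high_crest_eq by (simp del: atLeastAtMost_iff One_nat_def)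
    then show ?thesis by blast
  qed
qed

end

section \<open>Sorting in three passes\<close>

lemma precedes_entry_iff:
  assumes "distinct w" "x \<in> {1..length w}" "y \<in> {1..length w}"
  shows "precedes w (entry w x) (entry w y) \<longleftrightarrow> x < y"
proof -
  have "x - 1 < length w" "y - 1 < length w" "x - 1 < y - 1 \<longleftrightarrow> x < y"
    using assms(2,3) by auto
  then show ?thesis
    unfolding entry_def using precedes_nth_iff[OF assms(1)] by blast
qed

lemma set_eq_entry_image: "set w = entry w ` {1..length w}"
  unfolding image_Suc_lessThan[symmetric] image_image entry_def by (auto simp: set_conv_nth)

lemma stack_sort_inversion_iff:
  assumes "distinct w" "x \<in> {1..length w}" "y \<in> {1..length w}" "entry w y < entry w x"
  shows "precedes (stack_sort w) (entry w x) (entry w y) \<longleftrightarrow> overtaken {1..length w} (entry w) x y"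
proof -
  have "precedes (stack_sort w) (entry w x) (entry w y) \<longleftrightarrow>
      (\<exists>c. entry w x < c \<and> precedes w (entry w x) c \<and> precedes w c (entry w y))"
    using inversion_stack_sort assms(1,4) by blast
  also have "\<dots> \<longleftrightarrow> (\<exists>z\<in>{1..length w}. entry w x < entry w z \<and>
      precedes w (entry w x) (entry w z) \<and> precedes w (entry w z) (entry w y))"
    using precedes_in_set[of w] unfolding set_eq_entry_image[of w] by blast
  also have "\<dots> \<longleftrightarrow> overtaken {1..length w} (entry w) x y"
    using precedes_entry_iff[OF assms(1)] assms(2,3) unfolding overtaken_def by blast
  finally show ?thesis .
qed

text \<open>Apply the inversion criterion to \<open>stack_sort w\<close>. A larger entry
  \<open>z\<close> follows \<open>x\<close> there iff \<open>z\<close> is not overtaken before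
  \<open>x\<close> in \<open>w\<close>, and precedes \<open>y\<close> there iff \<open>z\<close> is
  overtaken before \<open>y\<close>.\<close>

lemma stack_sort_twice_inversion_iff:
  assumes "distinct w" "x \<in> {1..length w}" "y \<in> {1..length w}" "entry w y < entry w x"
  shows "precedes (stack_sort (stack_sort w)) (entry w x) (entry w y) \<longleftrightarrow>
    overtaken2 {1..length w} (entry w) x y"
proof -
  have "precedes (stack_sort (stack_sort w)) (entry w x) (entry w y) \<longleftrightarrow>
      (\<exists>c. entry w x < c \<and> precedes (stack_sort w) (entry w x) c \<and> precedes (stack_sort w) c (entry w y))"
    using inversion_stack_sort[OF distinct_stack_sort[OF assms(1)] assms(4)] by blast
  also have "\<dots> \<longleftrightarrow> (\<exists>z\<in>{1..length w}. entry w x < entry w z \<and>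
      precedes (stack_sort w) (entry w x) (entry w z) \<and> precedes (stack_sort w) (entry w z) (entry w y))"
    using precedes_in_set[of "stack_sort w"]
    unfolding set_stack_sort[OF assms(1)] set_eq_entry_image[of w] by blast
  also have "\<dots> \<longleftrightarrow> (\<exists>z\<in>{1..length w}. entry w x < entry w z \<and>
      \<not> overtaken {1..length w} (entry w) z x \<and> overtaken {1..length w} (entry w) z y)"
  proof (intro bex_cong refl conj_cong)
    fix z assume z: "z \<in> {1..length w}" and less: "entry w x < entry w z"
    have "precedes (stack_sort w) (entry w x) (entry w z) \<longleftrightarrow>
        \<not> precedes (stack_sort w) (entry w z) (entry w x)"
      using not_precedes_iff[OF distinct_stack_sort[OF assms(1)], of "entry w z" "entry w x"] z less assms(2)
      unfolding set_stack_sort[OF assms(1)] set_eq_entry_image[of w]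
      by (simp del: One_nat_def atLeastAtMost_iff)
    then show "precedes (stack_sort w) (entry w x) (entry w z) \<longleftrightarrow>
        \<not> overtaken {1..length w} (entry w) z x"
      using stack_sort_inversion_iff[OF assms(1) z assms(2) less] by blast
    show "precedes (stack_sort w) (entry w z) (entry w y) \<longleftrightarrow> overtaken {1..length w} (entry w) z y"
      using stack_sort_inversion_iff[OF assms(1) z assms(3)] less assms(4) by (meson less_trans)
  qed
  also have "\<dots> \<longleftrightarrow> overtaken2 {1..length w} (entry w) x y"
    \<comment> \<open>Only the occurrence with \<open>y\<close> is unfolded: its witness becomes
      \<open>e\<close>, while \<open>z\<close> becomes \<open>d\<close>.\<close>
    unfolding overtaken2_def overtaken_def[of _ _ _ y] by blast
  finally show ?thesis .
qed

text \<open>An inversion \<open>b a\<close> after the third pass needs a larger \<open>c\<close>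
  between them after two passes. That \<open>b\<close> precedes \<open>c\<close> is restated as
  \<open>c\<close> not preceding \<open>b\<close>, since \<open>overtaken2\<close> describes the
  pairs whose larger entry is named first.\<close>

lemma sorted_stack_sort_thrice_iff:
  assumes "distinct w"
  shows "sorted (stack_sort (stack_sort (stack_sort w))) \<longleftrightarrow> \<not> obstruction {1..length w} (entry w)"
proof -
  let ?A = "{1..length w}" and ?v = "entry w" and ?t = "stack_sort (stack_sort w)"
  have d: "distinct ?t" and s: "set ?t = ?v ` ?A"
    using assms by (simp_all only: distinct_stack_sort set_stack_sort set_eq_entry_image[symmetric])
  have "\<not> sorted (stack_sort ?t) \<longleftrightarrow> (\<exists>a b c. a < b \<and> b < c \<and> precedes ?t b c \<and> precedes ?t c a)"
    unfolding sorted_iff_no_inversion using inversion_stack_sort[OF d] by blast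
  also have "\<dots> \<longleftrightarrow> (\<exists>a\<in>?A. \<exists>b\<in>?A. \<exists>c\<in>?A. ?v a < ?v b \<and> ?v b < ?v c \<and>
      precedes ?t (?v c) (?v a) \<and> precedes ?t (?v b) (?v c))" (is "?L \<longleftrightarrow> ?R")
  proof
    assume ?L
    then obtain a b c where abc: "a < b" "b < c" "precedes ?t b c" "precedes ?t c a" by blast
    then have "a \<in> ?v ` ?A" "b \<in> ?v ` ?A" "c \<in> ?v ` ?A" using precedes_in_set[of ?t] unfolding s by blast+
    then show ?R using abc by blast
  qed blast
  also have "\<dots> \<longleftrightarrow> obstruction ?A ?v"
    unfolding obstruction_def
  proof (intro bex_cong refl conj_cong)
    fix a b c assume A: "a \<in> ?A" "b \<in> ?A" "c \<in> ?A" and less: "?v a < ?v b" "?v b < ?v c"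
    have "precedes ?t (?v b) (?v c) \<longleftrightarrow> \<not> precedes ?t (?v c) (?v b)"
      using not_precedes_iff[OF d, of "?v c" "?v b"] A less unfolding s
      by (simp del: One_nat_def atLeastAtMost_iff)
    then show "precedes ?t (?v b) (?v c) \<longleftrightarrow> \<not> overtaken2 ?A ?v c b"
      using stack_sort_twice_inversion_iff[OF assms A(3,2) less(2)] by blast
    show "precedes ?t (?v c) (?v a) \<longleftrightarrow> overtaken2 ?A ?v c a"
      using stack_sort_twice_inversion_iff[OF assms A(3,1)] less by (meson less_trans)
  qed
  finally show ?thesis by blast
qed

theorem theorem4p6:
  fixes \<pi> :: "nat list" and n :: nat
  assumes "\<pi> \<in> permutations_of_set {1..n}"
  shows "west_stack_sortable 3 \<pi> \<longleftrightarrow>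
    (\<forall>P \<in> {pat_I1, pat_I2, pat_I3, pat_I4, pat_I5, pat_J2_12,
            pat_J1_10, pat_J2_10, pat_J1_11, pat_J2_11}. avoids \<pi> P)"
proof -
  have d: "distinct \<pi>" and "set \<pi> = {1..n}"
    using assms by (auto simp: permutations_of_set_def)
  moreover from this have "length \<pi> = n" using distinct_card by fastforce
  ultimately have s: "set \<pi> = {1..length \<pi>}" by simp
  let ?s = "stack_sort (stack_sort (stack_sort \<pi>))"
  \<comment> \<open>The result is a rearrangement of 1 to \<open>n\<close>, so being the identity
    amounts to being sorted.\<close>
  have "distinct ?s" using d by (intro distinct_stack_sort)
  moreover have "set ?s = {1..length \<pi>}"
    using d s by (simp only: distinct_stack_sort set_stack_sort)
  then have "set ?s = set [1..<length \<pi> + 1]"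
    by (simp only: set_upt Suc_eq_plus1[symmetric] atLeastLessThanSuc_atLeastAtMost)
  ultimately have "?s = [1..<length \<pi> + 1] \<longleftrightarrow> sorted ?s"
    using sorted_distinct_set_unique[of ?s "[1..<length \<pi> + 1]"] by (metis distinct_upt sorted_upt)
  then have "west_stack_sortable 3 \<pi> \<longleftrightarrow> sorted ?s"
    by (simp add: west_stack_sortable_def numeral_3_eq_3)
  also have "\<dots> \<longleftrightarrow> \<not> (contains_I {1..length \<pi>} (entry \<pi>) \<or>
      (\<exists>c d b e a. crest {1..length \<pi>} (entry \<pi>) a b c d e) \<or>
      (\<exists>c f b d e a. high_crest {1..length \<pi>} (entry \<pi>) a b c d e f))"
    unfolding sorted_stack_sort_thrice_iff[OF d] obstruction_iff[OF finite_atLeastAtMost inj_on_entry[OF d s]] ..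
  also have "\<dots> \<longleftrightarrow> (\<forall>P \<in> {pat_I1, pat_I2, pat_I3, pat_I4, pat_I5, pat_J2_12,
      pat_J1_10, pat_J2_10, pat_J1_11, pat_J2_11}. avoids \<pi> P)"
    unfolding contains_I_iff[OF d s] crest_iff[OF d s] high_crest_iff[OF d s] by (simp, argo)
  finally show ?thesis .
qed

end
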